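(* Let $d\in\mathbb{N}$, $1<p<\infty$ and $0<\alpha<d\wedge 2$. The constant $\kappa_{(d-\alpha)/p}$ in the Hardy inequality $$\mathcal{E}_p[u]\ge\kappa_{(d-\alpha)/p}\int_{\mathbb{R}^d}\frac{|u(x)|^p}{|x|^\alpha}\,dx\quad\text{for all } u\in L^p(\mathbb{R}^d)$$ is sharp; that is, for no $\kappa>\kappa_{(d-\alpha)/p}$ does the inequality $\mathcal{E}_p[u]\ge\kappa\int_{\mathbb{R}^d}|u(x)|^p|x|^{-\alpha}\,dx$ hold for all $u\in L^p(\mathbb{R}^d)$.
   Context: Functions are real-valued and Borel measurable; $L^p(\mathbb{R}^d)$ is taken with respect to Lebesgue measure. $a\wedge b=\min\{a,b\}$. For $a,k\in\mathbb{R}$, $a^{\langle k\rangle}:=|a|^k\operatorname{sgn}a$, with $0^k:=0$. $\nu(x,y)=\mathcal{A}_{d,-\alpha}|y-x|^{-d-\alpha}$ for $x,y\in\mathbb{R}^d$, with $\mathcal{A}_{d,-\alpha}=2^{\alpha}\Gamma((d+\alpha)/2)\pi^{-d/2}/|\Gamma(-\alpha/2)|$. The Sobolev–Bregman form ($p$-form) is $$\mathcal{E}_p[u]:=\frac12\int_{\mathbb{R}^d}\int_{\mathbb{R}^d}(u(x)-u(y))\left(u(x)^{\langle p-1\rangle}-u(y)^{\langle p-1\rangle}\right)\nu(x,y)\,dy\,dx\in[0,\infty]$$ (the integrand is nonnegative). For $0<\beta<d-\alpha$, $$\kappa_\beta=\frac{2^\alpha\Gamma\big(\frac{\beta+\alpha}{2}\big)\Gamma\big(\frac{d-\beta}{2}\big)}{\Gamma\big(\frac{\beta}{2}\big)\Gamma\big(\frac{d-\beta-\alpha}{2}\big)}.$$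 *)

theory Defs
  imports "HOL-Analysis.Analysis"
begin

definition signed_powr :: "real \<Rightarrow> real \<Rightarrow> real"
  where "signed_powr a k = \<bar>a\<bar> powr k * sgn a"

text \<open>
  On the diagonal the kernel has the value \<open>0\<close> (as \<open>0 powr s = 0\<close>); this is harmless, since
  the increments of \<open>u\<close> that it multiplies vanish there.
\<close>

definition levy_kernel :: "real \<Rightarrow> 'a::euclidean_space \<Rightarrow> 'a \<Rightarrow> real"
  where "levy_kernel \<alpha> x y =
    2 powr \<alpha> * Gamma ((real DIM('a) + \<alpha>) / 2) * pi powr (- (real DIM('a) / 2)) / \<bar>Gamma (- \<alpha> / 2)\<bar>
      * norm (y - x) powr (- real DIM('a) - \<alpha>)"

text \<open>
  The form takes values in \<open>[0, \<infinity>]\<close>. The coercion \<^const>\<open>ennreal\<close>, which truncates negative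
  reals to \<open>0\<close>, does not affect the integrand, by the lemma \<open>bregman_integrand_nonneg\<close>.
\<close>

definition sobolev_bregman_form :: "real \<Rightarrow> real \<Rightarrow> ('a::euclidean_space \<Rightarrow> real) \<Rightarrow> ennreal"
  where "sobolev_bregman_form \<alpha> p u =
    1 / 2 * (\<integral>\<^sup>+x. (\<integral>\<^sup>+y. ennreal
      ((u x - u y) * (signed_powr (u x) (p - 1) - signed_powr (u y) (p - 1)) * levy_kernel \<alpha> x y)
      \<partial>lborel) \<partial>lborel)"

lemma signed_powr_mono:
  assumes "a \<le> b" "0 \<le> k"
  shows "signed_powr a k \<le> signed_powr b k"
proof -
  consider "0 \<le> a" | "a < 0" "0 \<le> b" | "b < 0" by linarith
  then show ?thesis
  proof cases
    case 1
    then show ?thesis using assms powr_mono2[of k a b]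
      by (cases "a = 0") (auto simp: signed_powr_def sgn_if)
  next
    case 2
    have "signed_powr a k \<le> 0" "0 \<le> signed_powr b k"
      using 2 by (auto simp: signed_powr_def sgn_if)
    then show ?thesis by linarith
  next
    case 3
    then show ?thesis using assms powr_mono2[of k "- b" "- a"]
      by (auto simp: signed_powr_def sgn_if)
  qed
qed

lemma bregman_integrand_nonneg:
  fixes x y :: "'a::euclidean_space"
  assumes "1 \<le> p" "0 < \<alpha>"
  shows "0 \<le> (u x - u y) * (signed_powr (u x) (p - 1) - signed_powr (u y) (p - 1))
    * levy_kernel \<alpha> x y"
proof -
  have "0 \<le> (u x - u y) * (signed_powr (u x) (p - 1) - signed_powr (u y) (p - 1))"
    using signed_powr_mono[of "u x" "u y" "p - 1"] signed_powr_mono[of "u y" "u x" "p - 1"] assms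
    by (cases "u x \<le> u y") (auto intro: mult_nonneg_nonneg mult_nonpos_nonpos)
  moreover have "0 \<le> levy_kernel \<alpha> x y"
    using assms by (auto simp: levy_kernel_def intro!: Gamma_real_nonneg)
  ultimately show ?thesis by simp
qed

definition Lp_functions :: "real \<Rightarrow> ('a::euclidean_space \<Rightarrow> real) set"
  where "Lp_functions p =
    {u. u \<in> borel_measurable borel \<and> integrable lborel (\<lambda>x. \<bar>u x\<bar> powr p)}"

definition hardy_constant :: "real \<Rightarrow> real \<Rightarrow> real \<Rightarrow> real"
  where "hardy_constant d \<alpha> \<beta> =
    2 powr \<alpha> * Gamma ((\<beta> + \<alpha>) / 2) * Gamma ((d - \<beta>) / 2)
      / (Gamma (\<beta> / 2) * Gamma ((d - \<beta> - \<alpha>) / 2))"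

end

theory Submission
  imports Defs "HOL-Probability.Distributions"
begin

text \<open>
  Write \<open>h\<^sub>\<gamma>(x) = |x|\<^sup>-\<^sup>\<gamma>\<close>, \<open>d\<close> for the dimension, and let \<open>\<beta> + \<beta>' = d - \<alpha>\<close> with \<open>\<beta>, \<beta>' > 0\<close>.
  For \<open>\<beta> = (d - \<alpha>) / p\<close> and \<open>\<beta>' = (p - 1) \<beta>\<close> the function \<open>u = h\<^sub>\<beta>\<close> is the virtual
  minimiser of the Hardy quotient: its signed power of order \<open>p - 1\<close> is \<open>h\<^sub>\<beta>'\<close>, and \<open>|u|\<^sup>p |x|\<^sup>-\<^sup>\<alpha> = |x|\<^sup>-\<^sup>d\<close>
  just fails to be integrable at the origin. The proof has two parts.

  The first part is the pointwise identity \<open>norm_powr_product_form\<close>: for \<open>x \<noteq> 0\<close>,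
  \<open>\<integral> (h\<^sub>\<beta>(x) - h\<^sub>\<beta>(y)) (h\<^sub>\<beta>'(x) - h\<^sub>\<beta>'(y)) \<nu>(x, y) dy = 2 \<kappa>\<^sub>\<beta> |x|\<^sup>-\<^sup>d\<close>.
  Both the kernel \<open>\<nu>\<close> and the powers \<open>h\<^sub>\<gamma>\<close> are mixtures of Gaussians \<open>exp (- s |x|\<^sup>2)\<close>, so that everything
  is computable by Tonelli. If \<open>Q\<^sub>s\<close> denotes convolution with the normalised Gaussian \<open>(s / \<pi>)\<^sup>d\<^sup>/\<^sup>2 exp (- s |x|\<^sup>2)\<close>
  (the heat semigroup at time \<open>1 / (4 s)\<close>), expanding the product gives
  \<open>h\<^sub>\<beta> (h\<^sub>\<beta>' - Q\<^sub>s h\<^sub>\<beta>') + h\<^sub>\<beta>' (h\<^sub>\<beta> - Q\<^sub>s h\<^sub>\<beta>) - (h\<^sub>d\<^sub>-\<^sub>\<alpha> - Q\<^sub>s h\<^sub>d\<^sub>-\<^sub>\<alpha>)\<close>, a combination of finite terms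
  without any principal value. Integrated against a suitable multiple of \<open>s\<^sup>\<alpha>\<^sup>/\<^sup>2\<^sup>-\<^sup>1 ds\<close>, each of the first two terms produces \<open>\<kappa>\<^sub>\<beta> |x|\<^sup>-\<^sup>d\<close>
  and the last one vanishes, since \<open>h\<^sub>d\<^sub>-\<^sub>\<alpha>\<close> is \<open>\<alpha>\<close>-harmonic off the origin
  (\<open>has_bochner_integral_semigroup_defect\<close>).

  The second part truncates \<open>h\<^sub>\<beta>\<close> to \<open>U = max 1 (min h\<^sub>\<beta> \<rho>\<^sup>-\<^sup>\<beta>) - 1\<close>, which is supported in the unit ball and constant
  for \<open>0 < |x| \<le> \<rho>\<close>. Truncation diminishes the product of increments of \<open>U\<close> and \<open>U\<^sup>r\<close>, \<open>r = \<beta>' / \<beta>\<close>, provided that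
  \<open>r \<ge> 1\<close> (\<open>clipped_increment_product_le\<close>). The identity of the first part therefore bounds the energy that comes from
  \<open>\<rho> / 2 \<le> |x| \<le> 2\<close> by \<open>\<kappa>\<^sub>\<beta>\<close> times the integral of \<open>|x|\<^sup>-\<^sup>d\<close> over that shell, which is a constant times \<open>ln (1 / \<rho>) + ln 4\<close>,
  while the points with \<open>|x| < \<rho> / 2\<close> or \<open>|x| > 2\<close> are far from almost every point at which \<open>U\<close> has a different value and contribute
  at most a constant independent of \<open>\<rho>\<close> (\<open>truncated_power_form_bound\<close>). The Hardy integral of \<open>U\<close> is at least \<open>\<theta>\<close> times the same
  logarithmic integral up to a constant, for any \<open>\<theta> < 1\<close> (\<open>truncated_power_Hardy_bound\<close>). Letting \<open>\<rho>\<close>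
  tend to \<open>0\<close> excludes every constant above \<open>\<kappa>\<^sub>\<beta>\<close>. The restriction \<open>r \<ge> 1\<close> is harmless: the energy is symmetric in \<open>u\<close> and its
  power, and \<open>\<kappa>\<^sub>\<beta> = \<kappa>\<^sub>d\<^sub>-\<^sub>\<alpha>\<^sub>-\<^sub>\<beta>\<close>, so for \<open>p < 2\<close> the roles of \<open>\<beta>\<close> and \<open>\<beta>'\<close> are exchanged.
\<close>

section \<open>Gamma and Gaussian integrals\<close>

lemma nn_integral_Gamma_scaled:
  fixes a c :: real
  assumes "a > 0" "c > 0"
  shows "(\<integral>\<^sup>+t. ennreal (indicator {0<..} t * (t powr (a - 1) * exp (- c * t))) \<partial>lborel)
    = ennreal (Gamma a * c powr (- a))"
proof -
  have 1: "ennreal (Gamma a) = (\<integral>\<^sup>+t. ennreal (indicator {0..} t * t powr (a - 1) / exp t) \<partial>lborel)"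
    using assms by (intro Gamma_conv_nn_integral_real)
  also have "\<dots> = ennreal \<bar>c\<bar> * (\<integral>\<^sup>+t. ennreal (indicator {0..} (0 + c * t) * (0 + c * t) powr (a - 1) / exp (0 + c * t)) \<partial>lborel)"
    using assms by (intro nn_integral_real_affine) auto
  also have "\<dots> = (\<integral>\<^sup>+t. ennreal c * ennreal (indicator {0..} (0 + c * t) * (0 + c * t) powr (a - 1) / exp (0 + c * t)) \<partial>lborel)"
    using assms by (subst nn_integral_cmult) auto
  also have "\<dots> = (\<integral>\<^sup>+t. ennreal (c powr a) * ennreal (indicator {0<..} t * (t powr (a - 1) * exp (- c * t))) \<partial>lborel)"
    using assms by (intro nn_integral_cong)
      (auto simp: indicator_def ennreal_mult' [symmetric] powr_mult exp_minus field_simps powr_diff zero_le_mult_iff)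
  also have "\<dots> = ennreal (c powr a) * (\<integral>\<^sup>+t. ennreal (indicator {0<..} t * (t powr (a - 1) * exp (- c * t))) \<partial>lborel)"
    by (subst nn_integral_cmult) auto
  finally have "ennreal (c powr - a) * ennreal (Gamma a) = ennreal (c powr - a) * ennreal (c powr a) *
      (\<integral>\<^sup>+t. ennreal (indicator {0<..} t * (t powr (a - 1) * exp (- c * t))) \<partial>lborel)"
    by (simp add: mult.assoc)
  also have "ennreal (c powr - a) * ennreal (c powr a) = 1"
    using assms by (simp add: ennreal_mult' [symmetric] powr_add [symmetric])
  finally show ?thesis using assms by (simp add: ennreal_mult' [symmetric] mult.commute)
qed

text \<open>
  In one dimension this is the normalisation of the normal density with variance \<open>1 / (2 c)\<close>; in general
  the integrand is a product over the coordinates.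
\<close>

lemma nn_integral_Gaussian:
  fixes m :: "'a::euclidean_space"
  assumes "c > 0"
  shows "(\<integral>\<^sup>+y. ennreal (exp (- c * (norm (y - m))\<^sup>2)) \<partial>lborel) = ennreal ((pi / c) powr (real DIM('a) / 2))"
proof -
  have one: "(\<integral>\<^sup>+t. ennreal (exp (- c * (t - \<mu>)\<^sup>2)) \<partial>lborel) = ennreal (sqrt (pi / c))" for \<mu> :: real
  proof -
    define s where "s = sqrt (1 / (2 * c))"
    have s: "s > 0" "s\<^sup>2 = 1 / (2 * c)" using assms by (auto simp: s_def)
    have "(\<integral>\<^sup>+t. ennreal (exp (- c * (t - \<mu>)\<^sup>2)) \<partial>lborel)
        = (\<integral>\<^sup>+t. ennreal (sqrt (pi / c)) * ennreal (normal_density \<mu> s t) \<partial>lborel)"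
    proof (intro nn_integral_cong)
      fix t
      have "2 * pi * s\<^sup>2 = pi / c" "(t - \<mu>)\<^sup>2 / (2 * s\<^sup>2) = c * (t - \<mu>)\<^sup>2"
        using assms by (simp_all add: s)
      then show "ennreal (exp (- c * (t - \<mu>)\<^sup>2)) = ennreal (sqrt (pi / c)) * ennreal (normal_density \<mu> s t)"
        using assms by (simp add: normal_density_def ennreal_mult' [symmetric])
    qed
    also have "\<dots> = ennreal (sqrt (pi / c)) * (\<integral>\<^sup>+t. ennreal (normal_density \<mu> s t) \<partial>lborel)"
      by (rule nn_integral_cmult) auto
    also have "(\<integral>\<^sup>+t. ennreal (normal_density \<mu> s t) \<partial>lborel) = 1"
      using s by (subst nn_integral_eq_integral) auto
    finally show ?thesis by simp
  qed
  have "(\<integral>\<^sup>+y. ennreal (exp (- c * (norm (y - m))\<^sup>2)) \<partial>lborel)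
     = (\<integral>\<^sup>+y. (\<Prod>b\<in>Basis. ennreal (exp (- c * (y \<bullet> b - m \<bullet> b)\<^sup>2))) \<partial>lborel)"
  proof (intro nn_integral_cong)
    fix y
    have "- c * (norm (y - m))\<^sup>2 = (\<Sum>b\<in>Basis. - c * (y \<bullet> b - m \<bullet> b)\<^sup>2)"
      unfolding power2_norm_eq_inner
      by (subst euclidean_inner) (simp add: power2_eq_square inner_diff_left sum_distrib_left)
    then show "ennreal (exp (- c * (norm (y - m))\<^sup>2)) = (\<Prod>b\<in>Basis. ennreal (exp (- c * (y \<bullet> b - m \<bullet> b)\<^sup>2)))"
      by (simp add: prod_ennreal exp_sum)
  qed
  also have "\<dots> = (\<Prod>b\<in>(Basis::'a set). (\<integral>\<^sup>+t. ennreal (exp (- c * (t - m \<bullet> b)\<^sup>2)) \<partial>lborel))"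
    by (rule nn_integral_lborel_prod) auto
  also have "\<dots> = ennreal (sqrt (pi / c) ^ DIM('a))"
    unfolding one using assms by (simp add: ennreal_power)
  also have "sqrt (pi / c) ^ DIM('a) = (pi / c) powr (real DIM('a) / 2)"
    using assms by (simp add: powr_half_sqrt [symmetric] powr_realpow [symmetric] powr_powr)
  finally show ?thesis .
qed

text \<open>
  Every negative power of the norm is a mixture of Gaussians. This applies both to the functions that are
  convolved and to the kernel of the form.
\<close>

lemma nn_integral_norm_powr_Gaussians:
  fixes z :: "'a::euclidean_space"
  assumes "g > 0" "z \<noteq> 0"
  shows "(\<integral>\<^sup>+s. ennreal (indicator {0<..} s * (s powr (g / 2 - 1) * exp (- s * (norm z)\<^sup>2))) \<partial>lborel)
    = ennreal (Gamma (g / 2) * norm z powr (- g))"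
proof -
  have "(norm z)\<^sup>2 powr (- (g / 2)) = norm z powr (- g)"
    using assms by (simp add: powr_powr powr_realpow [symmetric] del: powr_numeral)
  then show ?thesis
    using nn_integral_Gamma_scaled[of "g/2" "(norm z)\<^sup>2"] assms by (simp add: mult.commute)
qed

text \<open>
  Completing the square: with \<open>w = s / (s + t)\<close>, the exponent
  \<open>s |x - y|\<^sup>2 + t |y|\<^sup>2\<close> equals \<open>(s + t) |y - w x|\<^sup>2 + s t / (s + t) |x|\<^sup>2\<close>.
\<close>

lemma nn_integral_Gaussian_mult:
  fixes x :: "'a::euclidean_space"
  assumes "s > 0" "t > 0"
  shows "(\<integral>\<^sup>+y. ennreal (exp (- s * (norm (x - y))\<^sup>2) * exp (- t * (norm y)\<^sup>2)) \<partial>lborel)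
    = ennreal ((pi / (s + t)) powr (real DIM('a) / 2) * exp (- (s * t / (s + t)) * (norm x)\<^sup>2))"
proof -
  define w where "w = s / (s + t)"
  have w': "1 - w = t / (s + t)"
    using assms by (simp add: w_def field_simps)
  have w: "s = w * (s + t)" "t = (1 - w) * (s + t)" "s * t / (s + t) = w * (1 - w) * (s + t)"
    using assms unfolding w' by (simp_all add: w_def)
  have "s * (norm (x - y))\<^sup>2 + t * (norm y)\<^sup>2
    = (s + t) * (norm (y - w *\<^sub>R x))\<^sup>2 + s * t / (s + t) * (norm x)\<^sup>2" for y
  proof -
    have "w * (norm (x - y))\<^sup>2 + (1 - w) * (norm y)\<^sup>2 = (norm (y - w *\<^sub>R x))\<^sup>2 + w * (1 - w) * (norm x)\<^sup>2"
      by (simp add: power2_norm_eq_inner inner_diff_left inner_diff_right inner_commute[of y x])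
         algebra
    from arg_cong[OF this, of "\<lambda>r. r * (s + t)"] show ?thesis
      unfolding w(3) by (subst (1) w(1), subst (1) w(2)) (simp add: algebra_simps)
  qed
  then have "exp (- s * (norm (x - y))\<^sup>2) * exp (- t * (norm y)\<^sup>2)
     = exp (- (s * t / (s + t)) * (norm x)\<^sup>2) * exp (- (s + t) * (norm (y - w *\<^sub>R x))\<^sup>2)" for y
    by (simp add: exp_add [symmetric] algebra_simps)
  then show ?thesis
    using assms nn_integral_Gaussian[of "s + t" "w *\<^sub>R x"]
    by (simp add: ennreal_mult' nn_integral_cmult nn_integral_multc mult.commute)
qed

section \<open>Gaussian convolutions of powers of the norm\<close>

text \<open>
  The density in \<open>w\<close> that expresses the Gaussian convolution of a power of the norm as a mixture of the
  functions \<open>exp (- s w |x|\<^sup>2)\<close>, up to a factor that depends on \<open>g\<close> and \<open>s\<close> only, where \<open>R = |x|\<^sup>2\<close>. The variable \<open>w\<close> is the share of \<open>t\<close> in \<open>s + t\<close>, when \<open>s\<close> and \<open>t\<close> are the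
  parameters of the two Gaussians that are convolved.
\<close>

definition semigroup_density :: "real \<Rightarrow> real \<Rightarrow> real \<Rightarrow> real \<Rightarrow> real \<Rightarrow> real" where
  "semigroup_density d g R s w =
     indicator {0<..<1} w * (w powr (g / 2 - 1) * (1 - w) powr ((d - g) / 2 - 1) * exp (- s * w * R))"

lemma semigroup_density_measurable [measurable]: "semigroup_density d g R s \<in> borel_measurable borel"
  unfolding semigroup_density_def[abs_def] by measurable

lemma semigroup_density_nonneg: "semigroup_density d g R s w \<ge> 0"
  by (simp add: semigroup_density_def)

lemma integrable_Beta_Ioo:
  assumes "a > 0" "b > (0::real)"
  shows "integrable lborel (\<lambda>w. indicator {0<..<1} w * (w powr (a - 1) * (1 - w) powr (b - 1)))"
    and "(\<integral>w. indicator {0<..<1} w * (w powr (a - 1) * (1 - w) powr (b - 1)) \<partial>lborel) = Beta a b"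
proof -
  have "((\<lambda>w. w powr (a - 1) * (1 - w) powr (b - 1)) has_integral Beta a b) {0<..<1}"
    using has_integral_Beta_real[OF assms] by (simp add: has_integral_Icc_iff_Ioo)
  from nn_integral_has_integral_lebesgue[OF _ this]
  have "has_bochner_integral lborel (\<lambda>w. indicator {0<..<1} w * (w powr (a - 1) * (1 - w) powr (b - 1))) (Beta a b)"
    using assms by (intro has_bochner_integral_nn_integral) (auto simp: Beta_def intro!: divide_nonneg_pos mult_nonneg_nonneg)
  then show "integrable lborel (\<lambda>w. indicator {0<..<1} w * (w powr (a - 1) * (1 - w) powr (b - 1)))"
    and "(\<integral>w. indicator {0<..<1} w * (w powr (a - 1) * (1 - w) powr (b - 1)) \<partial>lborel) = Beta a b"
    by (auto simp: has_bochner_integral_iff)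
qed

lemma integrable_semigroup_density:
  assumes "0 < g" "g < d" "0 \<le> R" "0 \<le> s"
  shows "integrable lborel (semigroup_density d g R s)"
proof (rule Bochner_Integration.integrable_bound[OF integrable_Beta_Ioo(1)[of "g/2" "(d-g)/2"]])
  show "AE w in lborel. norm (semigroup_density d g R s w) \<le>
      norm (indicator {0<..<1} w * (w powr (g / 2 - 1) * (1 - w) powr ((d - g) / 2 - 1)))"
    using assms by (auto simp: semigroup_density_def indicator_def intro!: mult_left_le)
qed (use assms in auto)

text \<open>
  The substitution \<open>w = t / (s + t)\<close>, which maps the half line onto the unit interval.
\<close>

lemma nn_integral_semigroup_density_subst:
  fixes d g R s :: real
  assumes "0 < g" "g < d" "0 \<le> R" "0 < s"
  shows "(\<integral>\<^sup>+t. ennreal (indicator {0<..} t * (s / (s + t)\<^sup>2 * semigroup_density d g R s (t / (s + t)))) \<partial>lborel)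
    = ennreal (\<integral>w. semigroup_density d g R s w \<partial>lborel)"
proof -
  let ?f = "semigroup_density d g R s"
  define q where "q = (\<lambda>t. t / (s + t))"
  have img: "q ` {0<..} = {0<..<1}"
  proof (intro equalityI subsetI)
    fix w assume "w \<in> {0<..<1::real}"
    then have "q (s * w / (1 - w)) = w" "s * w / (1 - w) \<in> {0<..}"
      using assms by (auto simp: q_def divide_simps) (auto simp: algebra_simps)
    then show "w \<in> q ` {0<..}" by (metis imageI)
  qed (use assms in \<open>auto simp: q_def\<close>)
  have inj: "inj_on q {0<..}"
    using assms by (auto simp: inj_on_def q_def divide_simps) (auto simp: algebra_simps)
  have der: "(q has_field_derivative s / (s + t)\<^sup>2) (at t within {0<..})" if "t \<in> {0<..}" for t
    unfolding q_def using that assms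
    by (auto intro!: derivative_eq_intros simp: field_simps power2_eq_square)
  have ind: "(\<lambda>w. indicator {0<..<1} w *\<^sub>R ?f w) = ?f"
    by (auto simp: semigroup_density_def indicator_def)
  then have ind': "indicator {0<..<1} w * ?f w = ?f w" for w
    by (simp add: fun_eq_iff)
  have "set_integrable lborel {0<..<1} ?f"
    unfolding set_integrable_def ind using assms by (intro integrable_semigroup_density) auto
  from set_borel_integral_eq_integral[OF this]
  have f: "?f integrable_on {0<..<1}" "integral {0<..<1} ?f = (\<integral>w. ?f w \<partial>lborel)"
    by (simp_all add: set_lebesgue_integral_def ind')
  have "?f absolutely_integrable_on (q ` {0<..})"
    unfolding img using f(1) by (rule nonnegative_absolutely_integrable_1) (rule semigroup_density_nonneg)
  then have "(\<lambda>t. \<bar>s / (s + t)\<^sup>2\<bar> * ?f (q t)) absolutely_integrable_on {0<..} \<and>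
     integral {0<..} (\<lambda>t. \<bar>s / (s + t)\<^sup>2\<bar> * ?f (q t)) = (\<integral>w. ?f w \<partial>lborel)"
    using f(2) by (subst has_absolute_integral_change_of_variables_1'[OF _ der inj]) (auto simp: img)
  then have "((\<lambda>t. \<bar>s / (s + t)\<^sup>2\<bar> * ?f (q t)) has_integral (\<integral>w. ?f w \<partial>lborel)) {0<..}"
    unfolding has_integral_iff by (auto dest: set_lebesgue_integral_eq_integral(1))
  from nn_integral_has_integral_lebesgue[OF _ this] show ?thesis
    using assms by (simp add: q_def semigroup_density_nonneg)
qed

text \<open>
  Writing \<open>|y|\<^sup>-\<^sup>g\<close> as a mixture of the Gaussians \<open>exp (- t |y|\<^sup>2)\<close> reduces the integral over
  the space to \<open>nn_integral_Gaussian_mult\<close>; the substitution \<open>w = t / (s + t)\<close> turns what remains into an integral whose only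
  dependence on \<open>s\<close> is through \<open>s w\<close> and a power.
\<close>

lemma nn_integral_Gaussian_norm_powr:
  fixes x :: "'a::euclidean_space"
  assumes g: "0 < g" "g < real DIM('a)" and s: "s > 0"
  defines "J \<equiv> (\<integral>w. semigroup_density (real DIM('a)) g ((norm x)\<^sup>2) s w \<partial>lborel)"
  shows "(\<integral>\<^sup>+y. ennreal (exp (- s * (norm (x - y))\<^sup>2) * norm y powr (- g)) \<partial>lborel)
    = ennreal ((pi / s) powr (real DIM('a) / 2) * (s powr (g / 2) / Gamma (g / 2) * J))" (is "?I = _")
proof -
  let ?d = "real DIM('a)"
  have G: "Gamma (g / 2) > 0" using g by (intro Gamma_real_pos) auto
  have J: "J \<ge> 0" unfolding J_def by (intro integral_nonneg_AE) (auto simp: semigroup_density_nonneg)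
  have "ennreal (Gamma (g / 2)) * (\<integral>\<^sup>+y. ennreal (exp (- s * (norm (x - y))\<^sup>2) * norm y powr (- g)) \<partial>lborel)
    = (\<integral>\<^sup>+y. ennreal (exp (- s * (norm (x - y))\<^sup>2)) * ennreal (Gamma (g / 2) * norm y powr (- g)) \<partial>lborel)"
    using G by (subst nn_integral_cmult [symmetric]) (auto simp: ennreal_mult' [symmetric] mult_ac)
  also have "\<dots> = (\<integral>\<^sup>+y. ennreal (exp (- s * (norm (x - y))\<^sup>2)) *
       (\<integral>\<^sup>+t. ennreal (indicator {0<..} t * (t powr (g / 2 - 1) * exp (- t * (norm y)\<^sup>2))) \<partial>lborel) \<partial>lborel)"
  proof (rule nn_integral_cong_AE)
    show "AE y in lborel. ennreal (exp (- s * (norm (x - y))\<^sup>2)) * ennreal (Gamma (g / 2) * norm y powr (- g))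
      = ennreal (exp (- s * (norm (x - y))\<^sup>2)) *
       (\<integral>\<^sup>+t. ennreal (indicator {0<..} t * (t powr (g / 2 - 1) * exp (- t * (norm y)\<^sup>2))) \<partial>lborel)"
      using AE_lborel_singleton[of "0::'a"]
    proof eventually_elim
      case (elim y)
      show ?case unfolding nn_integral_norm_powr_Gaussians[OF g(1) elim] ..
    qed
  qed
  also have "\<dots> = (\<integral>\<^sup>+y. (\<integral>\<^sup>+t. ennreal (indicator {0<..} t * t powr (g / 2 - 1)) *
       ennreal (exp (- s * (norm (x - y))\<^sup>2) * exp (- t * (norm y)\<^sup>2)) \<partial>lborel) \<partial>lborel)"
    by (subst nn_integral_cmult [symmetric]) (auto simp: ennreal_mult' [symmetric] mult_ac)
  also have "\<dots> = (\<integral>\<^sup>+t. (\<integral>\<^sup>+y. ennreal (indicator {0<..} t * t powr (g / 2 - 1)) *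
       ennreal (exp (- s * (norm (x - y))\<^sup>2) * exp (- t * (norm y)\<^sup>2)) \<partial>lborel) \<partial>lborel)"
    by (rule lborel_pair.Fubini') measurable
  also have "\<dots> = (\<integral>\<^sup>+t. ennreal (indicator {0<..} t * t powr (g / 2 - 1)) *
       (\<integral>\<^sup>+y. ennreal (exp (- s * (norm (x - y))\<^sup>2) * exp (- t * (norm y)\<^sup>2)) \<partial>lborel) \<partial>lborel)"
    by (subst nn_integral_cmult) auto
  also have "\<dots> = (\<integral>\<^sup>+t. ennreal ((pi / s) powr (?d / 2) * s powr (g / 2)) *
       ennreal (indicator {0<..} t * (s / (s + t)\<^sup>2 * semigroup_density ?d g ((norm x)\<^sup>2) s (t / (s + t)))) \<partial>lborel)"
  proof (intro nn_integral_cong)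
    fix t :: real
    show "ennreal (indicator {0<..} t * t powr (g / 2 - 1)) *
       (\<integral>\<^sup>+y. ennreal (exp (- s * (norm (x - y))\<^sup>2) * exp (- t * (norm y)\<^sup>2)) \<partial>lborel)
      = ennreal ((pi / s) powr (?d / 2) * s powr (g / 2)) *
       ennreal (indicator {0<..} t * (s / (s + t)\<^sup>2 * semigroup_density ?d g ((norm x)\<^sup>2) s (t / (s + t))))"
    proof (cases "t > 0")
      case True
      have 1: "t / (s + t) \<in> {0<..<1}" using True s by auto
      have 2: "1 - t / (s + t) = s / (s + t)" using True s by (simp add: field_simps)
      have 3: "(s + t)\<^sup>2 = (s + t) powr 2" using True s by simp
      have e: "exp (- s * (t / (s + t)) * (norm x)\<^sup>2) = exp (- (s * t / (s + t)) * (norm x)\<^sup>2)" by simp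
      have "t powr (g / 2 - 1) * (pi / (s + t)) powr (?d / 2) =
        (pi / s) powr (?d / 2) * s powr (g / 2) * (s / (s + t) powr 2 *
          ((t / (s + t)) powr (g / 2 - 1) * (s / (s + t)) powr ((?d - g) / 2 - 1)))"
      proof -
        have "s powr (g / 2) * (s * s powr ((?d - g) / 2 - 1)) = s powr (?d / 2)"
          using s by (simp add: powr_mult_base powr_add [symmetric] diff_divide_distrib)
        moreover have "(s + t) powr 2 * ((s + t) powr (g / 2 - 1) * (s + t) powr ((?d - g) / 2 - 1)) = (s + t) powr (?d / 2)"
          by (simp add: powr_add [symmetric] diff_divide_distrib del: powr_numeral)
        ultimately show ?thesis
          using True s by (simp add: powr_divide del: powr_numeral) (simp add: field_simps del: powr_numeral)
      qed
      from arg_cong[OF this, of "\<lambda>r. r * exp (- (s * t / (s + t)) * (norm x)\<^sup>2)"]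
      have "t powr (g / 2 - 1) * ((pi / (s + t)) powr (?d / 2) * exp (- (s * t / (s + t)) * (norm x)\<^sup>2)) =
        (pi / s) powr (?d / 2) * s powr (g / 2) * (s / (s + t)\<^sup>2 * semigroup_density ?d g ((norm x)\<^sup>2) s (t / (s + t)))"
        using 1 unfolding semigroup_density_def 2 e 3 by (simp only: indicator_simps mult_1 mult.assoc)
      then show ?thesis
        using True s by (subst nn_integral_Gaussian_mult) (auto simp: ennreal_mult' [symmetric])
    qed simp
  qed
  also have "\<dots> = ennreal ((pi / s) powr (?d / 2) * s powr (g / 2)) * ennreal J"
    unfolding J_def using g s by (simp add: nn_integral_cmult nn_integral_semigroup_density_subst del: times_divide_eq_right times_divide_eq_left)
  finally have *: "ennreal (Gamma (g / 2)) * ?I = ennreal ((pi / s) powr (?d / 2) * s powr (g / 2)) * ennreal J" .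
  have "?I = ennreal (1 / Gamma (g / 2)) * (ennreal (Gamma (g / 2)) * ?I)"
    using G unfolding mult.assoc [symmetric] by (simp add: ennreal_mult' [symmetric])
  also have "\<dots> = ennreal (1 / Gamma (g / 2) * ((pi / s) powr (?d / 2) * s powr (g / 2) * J))"
    unfolding * using G J by (simp add: ennreal_mult' [symmetric])
  also have "1 / Gamma (g / 2) * ((pi / s) powr (?d / 2) * s powr (g / 2) * J) = (pi / s) powr (?d / 2) * (s powr (g / 2) / Gamma (g / 2) * J)"
    by simp
  finally show ?thesis .
qed

section \<open>The fractional Laplacian of a power, without principal values\<close>

lemma has_bochner_integral_Gamma_scaled:
  fixes a c :: real
  assumes "a > 0" "c > 0"
  shows "has_bochner_integral lborel (\<lambda>t. indicator {0<..} t * (t powr (a - 1) * exp (- c * t))) (Gamma a * c powr (- a))"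
  using nn_integral_Gamma_scaled[OF assms] assms
  by (intro has_bochner_integral_nn_integral) (auto simp: Gamma_real_nonneg)

text \<open>
  The value is \<open>- B(- a, b)\<close> for the analytically continued Beta function: subtracting \<open>1\<close> regularises the
  divergent Beta integral at \<open>0\<close>. Since \<open>(1 - w)\<^sup>b\<^sup>-\<^sup>1 = (1 - w)\<^sup>b + w (1 - w)\<^sup>b\<^sup>-\<^sup>1\<close>, the integrand on the unit interval is
  \<open>w\<^sup>-\<^sup>a\<^sup>-\<^sup>1 (1 - (1 - w)\<^sup>b)\<close>, which is nonnegative and is integrated by parts, minus an honest Beta density. The boundary term
  at \<open>1\<close> cancels the integral over the half line from \<open>1\<close>, where the integrand is \<open>w\<^sup>-\<^sup>a\<^sup>-\<^sup>1\<close>.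
\<close>

lemma has_bochner_integral_defect_kernel:
  fixes a b :: real
  assumes a: "0 < a" "a < 1" and b: "b > 0"
  shows "has_bochner_integral lborel
    (\<lambda>w. indicator {0<..} w * (w powr (- a - 1) * (1 - indicator {..<1} w * (1 - w) powr (b - 1))))
    ((b - a) / a * Beta (1 - a) b)"
proof -
  let ?B = "Beta (1 - a) b"
  \<comment> \<open>Integration by parts: \<open>F\<close> is a primitive of the first part up to a multiple of the Beta density.\<close>
  define F where "F = (\<lambda>w::real. - (1 / a) * (w powr (- a) * (1 - (1 - w) powr b)))"
  have tail: "has_bochner_integral lborel (\<lambda>w. indicator {1..} w * w powr (- a - 1)) (1 / a)"
  proof (rule has_bochner_integral_nn_integral)
    have "((\<lambda>w::real. w powr (- a)) \<longlongrightarrow> 0) at_top"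
      using a by (intro tendsto_neg_powr filterlim_ident) auto
    then have "((\<lambda>w::real. - (1 / a) * w powr (- a)) \<longlongrightarrow> 0) at_top"
      by (rule tendsto_mult_right_zero)
    then have "(\<integral>\<^sup>+w. ennreal (w powr (- a - 1)) * indicator {1..} w \<partial>lborel) = ennreal (0 - (- (1 / a) * 1 powr (- a)))"
      using a by (intro nn_integral_FTC_atLeast) (auto intro!: derivative_eq_intros)
    then show "(\<integral>\<^sup>+w. ennreal (indicator {1..} w * w powr (- a - 1)) \<partial>lborel) = ennreal (1 / a)"
      by (simp add: ennreal_mult' mult.commute ennreal_indicator)
  qed (use a in auto)
  have beta: "has_bochner_integral lborel (\<lambda>w. indicator {0<..<1} w * (w powr (- a) * (1 - w) powr (b - 1))) ?B"
    using integrable_Beta_Ioo[of "1 - a" b] a b by (simp add: has_bochner_integral_iff)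
  have lim0: "((\<lambda>w. w powr (- a) * (1 - (1 - w) powr b)) \<longlongrightarrow> 0) (at_right 0)"
  proof -
    \<comment> \<open>The quotient tends to the derivative \<open>b\<close>, and \<open>1 - a > 0\<close> leaves a vanishing power.\<close>
    have "((\<lambda>w. 1 - (1 - w) powr b) has_real_derivative b) (at 0)"
      by (auto intro!: derivative_eq_intros)
    then have "((\<lambda>w. (1 - (1 - w) powr b) / w) \<longlongrightarrow> b) (at 0)"
      by (simp add: has_field_derivative_iff)
    then have "((\<lambda>w. (1 - (1 - w) powr b) / w) \<longlongrightarrow> b) (at_right 0)"
      by (rule tendsto_mono[rotated]) (simp add: at_le)
    moreover have "((\<lambda>w. w powr (1 - a)) \<longlongrightarrow> 0) (at_right 0)"
      using a by (auto intro!: tendsto_eq_intros simp: eventually_at_filter)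
    ultimately have "((\<lambda>w. w powr (1 - a) * ((1 - (1 - w) powr b) / w)) \<longlongrightarrow> 0 * b) (at_right 0)"
      by (intro tendsto_mult)
    moreover have "eventually (\<lambda>w. w powr (1 - a) * ((1 - (1 - w) powr b) / w) = w powr (- a) * (1 - (1 - w) powr b)) (at_right (0::real))"
      using eventually_at_right_less[of 0] by eventually_elim (simp add: powr_diff powr_minus field_simps)
    ultimately show ?thesis by (simp cong: filterlim_cong add: tendsto_cong)
  qed
  have contF: "continuous_on {0..1} F"
    unfolding continuous_on_def
  proof
    fix w :: real assume w: "w \<in> {0..1}"
    show "(F \<longlongrightarrow> F w) (at w within {0..1})"
    proof (cases "w = 0")
      case True
      have "(F \<longlongrightarrow> - (1 / a) * 0) (at_right 0)"
        unfolding F_def by (intro tendsto_mult tendsto_const lim0)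
      then show ?thesis using True by (simp add: F_def at_within_Icc_at_right)
    next
      case False
      then show ?thesis unfolding F_def using w a b
        by (auto intro!: tendsto_intros tendsto_powr' simp: eventually_at_filter)
    qed
  qed
  have "((\<lambda>w. w powr (- a - 1) * (1 - (1 - w) powr b) - b / a * (w powr (- a) * (1 - w) powr (b - 1)))
     has_integral (F 1 - F 0)) {0..1}"
  proof (rule fundamental_theorem_of_calculus_interior[OF _ contF])
    fix w :: real assume w: "w \<in> {0<..<1}"
    show "(F has_vector_derivative w powr (- a - 1) * (1 - (1 - w) powr b) - b / a * (w powr (- a) * (1 - w) powr (b - 1))) (at w)"
      unfolding F_def has_real_derivative_iff_has_vector_derivative [symmetric] using w a
      by (auto intro!: derivative_eq_intros simp: field_simps)
  qed simp
  then have "((\<lambda>w. (w powr (- a - 1) * (1 - (1 - w) powr b) - b / a * (w powr (- a) * (1 - w) powr (b - 1)))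
     + b / a * (w powr (1 - a - 1) * (1 - w) powr (b - 1))) has_integral (F 1 - F 0 + b / a * ?B)) {0..1}"
    using a b by (intro has_integral_add has_integral_mult_right has_integral_Beta_real) auto
  then have "((\<lambda>w. w powr (- a - 1) * (1 - (1 - w) powr b)) has_integral (F 1 - F 0 + b / a * ?B)) {0<..<1}"
    by (simp add: has_integral_Icc_iff_Ioo)
  moreover have "F 1 - F 0 + b / a * ?B = b / a * ?B - 1 / a"
    using b by (simp add: F_def)
  ultimately have I: "((\<lambda>w. w powr (- a - 1) * (1 - (1 - w) powr b)) has_integral (b / a * ?B - 1 / a)) {0<..<1}"
    by simp
  have nn: "0 \<le> w powr (- a - 1) * (1 - (1 - w) powr b)" if "w \<in> {0<..<1}" for w
    using that b powr_mono2[of b "1 - w" 1] by auto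
  have head: "has_bochner_integral lborel (\<lambda>w. indicator {0<..<1} w * (w powr (- a - 1) * (1 - (1 - w) powr b))) (b / a * ?B - 1 / a)"
    using nn_integral_has_integral_lebesgue[OF nn I] has_integral_nonneg[OF I nn] nn
    by (intro has_bochner_integral_nn_integral) (auto simp: indicator_def)
  have "has_bochner_integral lborel (\<lambda>w. indicator {0<..<1} w * (w powr (- a - 1) * (1 - (1 - w) powr b))
      - indicator {0<..<1} w * (w powr (- a) * (1 - w) powr (b - 1)) + indicator {1..} w * w powr (- a - 1))
      (b / a * ?B - 1 / a - ?B + 1 / a)"
    by (intro has_bochner_integral_add has_bochner_integral_diff head beta tail)
  moreover have "indicator {0<..<1} w * (w powr (- a - 1) * (1 - (1 - w) powr b))
      - indicator {0<..<1} w * (w powr (- a) * (1 - w) powr (b - 1)) + indicator {1..} w * w powr (- a - 1)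
      = indicator {0<..} w * (w powr (- a - 1) * (1 - indicator {..<1} w * (1 - w) powr (b - 1)))" for w
  proof (cases "w \<in> {0<..<1}")
    case True
    have 1: "w powr (- a) = w * w powr (- a - 1)" "(1 - w) powr b = (1 - w) * (1 - w) powr (b - 1)"
      using True by (simp_all add: powr_diff)
    show ?thesis unfolding 1 using True by (simp add: indicator_def) (simp add: algebra_simps)
  qed (auto simp: indicator_def)
  moreover have "b / a * ?B - 1 / a - ?B + 1 / a = (b - a) / a * ?B"
    using a by (simp add: field_simps)
  ultimately show ?thesis by simp
qed

text \<open>
  The difference between \<open>h(x) = |x|\<^sup>-\<^sup>g\<close> and its Gaussian convolution, integrated against \<open>s\<^sup>a\<^sup>-\<^sup>1 ds\<close>, is up to a constant
  the fractional Laplacian of \<open>h\<close> of order \<open>2 a\<close> at \<open>x\<close>. As \<open>h\<close> itself is the mixture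
  of the functions \<open>exp (- s w |x|\<^sup>2)\<close> with density \<open>w\<^sup>g\<^sup>/\<^sup>2\<^sup>-\<^sup>1\<close> on the whole half line, the difference has density
  \<open>w\<^sup>g\<^sup>/\<^sup>2\<^sup>-\<^sup>1 e(w)\<close> with the factor \<open>e\<close> of \<open>has_bochner_integral_defect_kernel\<close>. Integrating over \<open>s\<close> first leaves
  \<open>w\<^sup>-\<^sup>a\<^sup>-\<^sup>1 e(w)\<close>, which is absolutely integrable, so Fubini applies although \<open>e\<close> need not have a constant sign.
\<close>

lemma has_bochner_integral_semigroup_defect:
  fixes a d g R :: real
  assumes a: "0 < a" "a < 1" and g: "0 < g" "g < d" and R: "R > 0"
  shows "has_bochner_integral lborel
     (\<lambda>s. indicator {0<..} s * (s powr (a - 1) *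
        (R powr (- (g / 2)) - s powr (g / 2) / Gamma (g / 2) * (\<integral>w. semigroup_density d g R s w \<partial>lborel))))
     (Gamma (a + g / 2) / Gamma (g / 2) * R powr (- (a + g / 2)) * (((d - g) / 2 - a) / a * Beta (1 - a) ((d - g) / 2)))"
proof -
  define b where "b = (d - g) / 2"
  have b: "b > 0" using g by (simp add: b_def)
  have G: "Gamma (g / 2) > 0" "Gamma (a + g / 2) > 0" using g a by (auto intro!: Gamma_real_pos)
  define e where "e = (\<lambda>w::real. 1 - indicator {..<1} w * (1 - w) powr (b - 1))"
  have [measurable]: "e \<in> borel_measurable borel" by (simp add: e_def)
  define k where "k = (\<lambda>w s::real. indicator {0<..} s * (s powr (a + g / 2 - 1) * exp (- (w * R) * s)))"
  define f where "f = (\<lambda>(w, s). indicator {0<..} w * (w powr (g / 2 - 1) * e w) * k w s)"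
  have [measurable]: "case_prod k \<in> borel_measurable (borel \<Otimes>\<^sub>M borel)" unfolding k_def by measurable
  have fm: "f \<in> borel_measurable (lborel \<Otimes>\<^sub>M lborel)" unfolding f_def k_def by measurable
  have k: "has_bochner_integral lborel (k w) (Gamma (a + g / 2) * (w * R) powr (- (a + g / 2)))" if "w > 0" for w
    unfolding k_def using that a g R by (intro has_bochner_integral_Gamma_scaled) auto
  have pw: "w powr (g / 2 - 1) * (w * R) powr (- (a + g / 2)) = R powr (- (a + g / 2)) * w powr (- a - 1)" if "w > 0" for w
  proof -
    have "w powr (g / 2 - 1) * w powr (- (a + g / 2)) = w powr (- a - 1)"
      unfolding powr_add [symmetric] by (rule arg_cong) simp
    then show ?thesis using that R by (simp add: powr_mult)
  qed
  have M: "has_bochner_integral lborel (\<lambda>w. indicator {0<..} w * (w powr (- a - 1) * e w)) ((b - a) / a * Beta (1 - a) b)"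
    unfolding e_def by (rule has_bochner_integral_defect_kernel[OF a b])
  have intf: "integrable (lborel \<Otimes>\<^sub>M lborel) f"
  proof (rule lborel_pair.Fubini_integrable[OF fm])
    have "(\<integral>s. norm (f (w, s)) \<partial>lborel) =
       Gamma (a + g / 2) * R powr (- (a + g / 2)) * norm (indicator {0<..} w * (w powr (- a - 1) * e w))" for w
    proof (cases "w > 0")
      case True
      have "(\<integral>s. norm (f (w, s)) \<partial>lborel) = (\<integral>s. w powr (g / 2 - 1) * \<bar>e w\<bar> * k w s \<partial>lborel)"
        using True by (intro Bochner_Integration.integral_cong) (auto simp: f_def k_def abs_mult)
      also have "\<dots> = w powr (g / 2 - 1) * \<bar>e w\<bar> * (Gamma (a + g / 2) * (w * R) powr (- (a + g / 2)))"
        using k[OF True] by (simp add: has_bochner_integral_iff)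
      also have "\<dots> = \<bar>e w\<bar> * Gamma (a + g / 2) * (w powr (g / 2 - 1) * (w * R) powr (- (a + g / 2)))"
        by (simp only: mult_ac)
      finally show ?thesis using True unfolding pw[OF True] by (simp add: abs_mult mult_ac)
    qed (auto simp: f_def)
    then show "integrable lborel (\<lambda>w. \<integral>s. norm (f (w, s)) \<partial>lborel)"
      using M by (simp only:) (intro integrable_mult_right integrable_norm, simp add: has_bochner_integral_iff)
    show "AE w in lborel. integrable lborel (\<lambda>s. f (w, s))"
    proof (rule AE_I2)
      fix w :: real
      show "integrable lborel (\<lambda>s. f (w, s))"
        by (cases "w > 0") (use k[of w] in \<open>auto simp: f_def has_bochner_integral_iff\<close>)
    qed
  qed
  have fst: "(\<integral>s. f (w, s) \<partial>lborel) =
       Gamma (a + g / 2) * R powr (- (a + g / 2)) * (indicator {0<..} w * (w powr (- a - 1) * e w))" for w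
  proof (cases "w > 0")
    case True
    have "(\<integral>s. f (w, s) \<partial>lborel) = w powr (g / 2 - 1) * e w * (Gamma (a + g / 2) * (w * R) powr (- (a + g / 2)))"
      using k[OF True] True by (simp add: has_bochner_integral_iff f_def)
    also have "\<dots> = e w * Gamma (a + g / 2) * (w powr (g / 2 - 1) * (w * R) powr (- (a + g / 2)))"
      by (simp only: mult_ac)
    finally show ?thesis using True unfolding pw[OF True] by (simp add: mult_ac)
  qed (auto simp: f_def)
  have snd: "(\<integral>w. f (w, s) \<partial>lborel) = Gamma (g / 2) * (indicator {0<..} s * (s powr (a - 1) *
        (R powr (- (g / 2)) - s powr (g / 2) / Gamma (g / 2) * (\<integral>w. semigroup_density d g R s w \<partial>lborel))))" for s
  proof (cases "s > 0")
    case True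
    have 1: "has_bochner_integral lborel (\<lambda>t. indicator {0<..} t * (t powr (g / 2 - 1) * exp (- (s * R) * t))) (Gamma (g / 2) * (s * R) powr (- (g / 2)))"
      using True R g by (intro has_bochner_integral_Gamma_scaled) auto
    have 2: "has_bochner_integral lborel (semigroup_density d g R s) (\<integral>w. semigroup_density d g R s w \<partial>lborel)"
      using integrable_semigroup_density[of g d R s] g R True by (simp add: has_bochner_integral_iff)
    have "has_bochner_integral lborel (\<lambda>w. s powr (a + g / 2 - 1) *
       (indicator {0<..} w * (w powr (g / 2 - 1) * exp (- (s * R) * w)) - semigroup_density d g R s w))
       (s powr (a + g / 2 - 1) * (Gamma (g / 2) * (s * R) powr (- (g / 2)) - (\<integral>w. semigroup_density d g R s w \<partial>lborel)))"
      by (intro has_bochner_integral_mult_right has_bochner_integral_diff 1 2)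
    moreover have "f (w, s) = s powr (a + g / 2 - 1) *
       (indicator {0<..} w * (w powr (g / 2 - 1) * exp (- (s * R) * w)) - semigroup_density d g R s w)" for w
      using True by (auto simp: f_def k_def e_def b_def semigroup_density_def indicator_def algebra_simps)
    ultimately have "(\<integral>w. f (w, s) \<partial>lborel) = s powr (a + g / 2 - 1) * (Gamma (g / 2) * (s * R) powr (- (g / 2)) - (\<integral>w. semigroup_density d g R s w \<partial>lborel))"
      by (simp add: has_bochner_integral_iff)
    also have "s powr (a + g / 2 - 1) = s powr (a - 1) * s powr (g / 2)"
      unfolding powr_add [symmetric] by (rule arg_cong) simp
    also have "(s * R) powr (- (g / 2)) = R powr (- (g / 2)) / s powr (g / 2)"
      using True R by (simp add: powr_mult powr_minus field_simps)
    finally show ?thesis using True G by (simp add: algebra_simps)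
  qed (auto simp: f_def k_def)
  have "integrable lborel (\<lambda>s. \<integral>w. f (w, s) \<partial>lborel)"
    and "(\<integral>s. (\<integral>w. f (w, s) \<partial>lborel) \<partial>lborel) = (\<integral>w. (\<integral>s. f (w, s) \<partial>lborel) \<partial>lborel)"
    using lborel_pair.integrable_snd[of "\<lambda>w s. f (w, s)"] lborel_pair.Fubini_integral[of "\<lambda>w s. f (w, s)"] intf by auto
  then have "has_bochner_integral lborel (\<lambda>s. \<integral>w. f (w, s) \<partial>lborel) (\<integral>w. (\<integral>s. f (w, s) \<partial>lborel) \<partial>lborel)"
    by (simp add: has_bochner_integral_iff)
  also have "(\<integral>w. (\<integral>s. f (w, s) \<partial>lborel) \<partial>lborel) =
      Gamma (a + g / 2) * R powr (- (a + g / 2)) * ((b - a) / a * Beta (1 - a) b)"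
    unfolding fst using M by (simp only: has_bochner_integral_iff integral_mult_right_zero)
  finally have "has_bochner_integral lborel (\<lambda>s. 1 / Gamma (g / 2) * (\<integral>w. f (w, s) \<partial>lborel))
      (1 / Gamma (g / 2) * (Gamma (a + g / 2) * R powr (- (a + g / 2)) * ((b - a) / a * Beta (1 - a) b)))"
    by (rule has_bochner_integral_mult_right)
  then show ?thesis
    unfolding snd using G by (simp add: b_def)
qed

section \<open>The form of two powers of the norm\<close>

lemma nn_integral_eq_has_bochner_integral:
  "has_bochner_integral M f I \<Longrightarrow> (AE x in M. 0 \<le> f x) \<Longrightarrow> (\<integral>\<^sup>+x. ennreal (f x) \<partial>M) = ennreal I"
  by (auto simp: has_bochner_integral_iff nn_integral_eq_integral)

text \<open>
  Exchanging a function with its power of order \<open>p - 1\<close> exchanges \<open>p\<close> with its conjugate exponent and \<open>\<beta>\<close> with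
  \<open>d - \<alpha> - \<beta>\<close>. The two quotients of Gamma values that make up the constant are thereby only permuted.
\<close>

lemma hardy_constant_dual: "hardy_constant d \<alpha> (d - \<alpha> - \<beta>) = hardy_constant d \<alpha> \<beta>"
  by (simp add: hardy_constant_def algebra_simps)

lemma abs_Gamma_minus:
  fixes a :: real
  assumes "0 < a" "a < 1"
  shows "\<bar>Gamma (- a)\<bar> = Gamma (1 - a) / a"
proof -
  have "- a \<notin> \<int>\<^sub>\<le>\<^sub>0"
  proof
    assume "- a \<in> \<int>\<^sub>\<le>\<^sub>0"
    then obtain n where "- a = real_of_int n" by (elim nonpos_Ints_cases)
    then have "-1 < n" "n < 0" using assms by linarith+
    then show False by simp
  qed
  from Gamma_plus1[OF this] have "Gamma (1 - a) = - a * Gamma (- a)" by (simp add: add.commute)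
  moreover have "Gamma (1 - a) > 0" using assms by (intro Gamma_real_pos) auto
  ultimately show ?thesis using assms by (simp add: field_simps mult_less_0_iff zero_less_mult_iff)
qed

text \<open>
  The case \<open>b = a\<close>, where the left-hand side is \<open>0\<close>, is left out because there \<open>Gamma\<close> has a pole at \<open>b - a\<close>.
\<close>

lemma defect_kernel_integral_eq_Gamma:
  fixes a b :: real
  assumes a: "0 < a" "a < 1" and b: "a < b"
  shows "(b - a) / a * Beta (1 - a) b = \<bar>Gamma (- a)\<bar> * Gamma b / Gamma (b - a)"
proof -
  have "b - a \<notin> \<int>\<^sub>\<le>\<^sub>0" using b by (auto elim!: nonpos_Ints_cases)
  from Gamma_plus1[OF this] have "Gamma (1 - a + b) = (b - a) * Gamma (b - a)"
    by (simp add: algebra_simps)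
  moreover have "Gamma (b - a) > 0" using b by (intro Gamma_real_pos) auto
  ultimately show ?thesis using a b by (simp add: abs_Gamma_minus Beta_def)
qed

text \<open>
  This identity is where the constant comes from. The product of differences expands into
  \<open>h h' - h h'(y) - h' h(y) + h''(y)\<close> with \<open>h'' = h h'\<close> the power of exponent \<open>d - \<alpha>\<close>. Against a fixed Gaussian every term is
  finite, and the terms regroup into three differences between a power and its convolution. For the exponent \<open>d - \<alpha>\<close> the parameter
  \<open>b = (d - (d - \<alpha>)) / 2\<close> equals \<open>a = \<alpha> / 2\<close>, and the integral of the difference vanishes.
\<close>

lemma norm_powr_product_form:
  fixes x :: "'a::euclidean_space"
  assumes \<alpha>: "0 < \<alpha>" "\<alpha> < 2" and \<beta>: "0 < \<beta>" "0 < \<beta>'" "\<beta> + \<beta>' = real DIM('a) - \<alpha>" and x: "x \<noteq> 0"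
  shows "(\<integral>\<^sup>+y. ennreal ((norm x powr (- \<beta>) - norm y powr (- \<beta>)) * (norm x powr (- \<beta>') - norm y powr (- \<beta>'))
      * levy_kernel \<alpha> x y) \<partial>lborel)
    = ennreal (2 * hardy_constant (real DIM('a)) \<alpha> \<beta> * norm x powr (- real DIM('a)))"
proof -
  let ?d = "real DIM('a)"
  define a where "a = \<alpha> / 2"
  have a: "0 < a" "a < 1" using \<alpha> by (auto simp: a_def)
  define R where "R = (norm x)\<^sup>2"
  have R: "R > 0" using x by (simp add: R_def)
  have Rp: "R powr (- (g / 2)) = norm x powr (- g)" for g
    using x by (simp add: R_def powr_powr powr_realpow [symmetric] del: powr_numeral)
  define h where "h = (\<lambda>g (y::'a). norm y powr (- g))"
  have [measurable]: "h g \<in> borel_measurable borel" for g by (simp add: h_def)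
  have hh: "h \<beta> y * h \<beta>' y = h (?d - \<alpha>) y" for y
  proof -
    have "- \<beta> + - \<beta>' = - (?d - \<alpha>)" using \<beta>(3) by simp
    then show ?thesis by (simp only: h_def powr_add [symmetric])
  qed
  define P where "P = (\<lambda>y. (h \<beta> x - h \<beta> y) * (h \<beta>' x - h \<beta>' y))"
  have [measurable]: "P \<in> borel_measurable borel" by (simp add: P_def)
  have P: "0 \<le> P y" if "y \<noteq> 0" for y
  proof (cases "norm x \<le> norm y")
    case True
    then show ?thesis using that x \<beta> unfolding P_def h_def
      by (intro mult_nonneg_nonneg) (auto intro!: powr_mono2')
  next
    case False
    then show ?thesis using that x \<beta> unfolding P_def h_def
      by (intro mult_nonpos_nonpos) (auto intro!: powr_mono2')
  qed
  define Q where "Q = (\<lambda>g s. s powr (g / 2) / Gamma (g / 2) * (\<integral>w. semigroup_density ?d g R s w \<partial>lborel))"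
  \<comment> \<open>\<open>Q g s\<close> is the Gaussian convolution of \<open>h g\<close> at \<open>x\<close>, and \<open>V g\<close> the integral of \<open>h g x - Q g s\<close> over \<open>s\<close>.\<close>
  define V where "V = (\<lambda>g. Gamma (a + g / 2) / Gamma (g / 2) * R powr (- (a + g / 2)) * (((?d - g) / 2 - a) / a * Beta (1 - a) ((?d - g) / 2)))"
  define A where "A = 2 powr \<alpha> * pi powr (- (?d / 2)) / \<bar>Gamma (- a)\<bar>"
  have Ga: "\<bar>Gamma (- a)\<bar> > 0"
    using a by (simp add: abs_Gamma_minus)
  have A: "A > 0" using Ga by (simp add: A_def)
  have hQ: "has_bochner_integral lborel (\<lambda>y. exp (- s * (norm (x - y))\<^sup>2) * h g y) ((pi / s) powr (?d / 2) * Q g s)"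
    if "0 < g" "g < ?d" "0 < s" for g s
  proof (rule has_bochner_integral_nn_integral)
    have "Gamma (g / 2) \<ge> 0" using that by (intro Gamma_real_nonneg) auto
    then show "0 \<le> (pi / s) powr (?d / 2) * Q g s"
      unfolding Q_def by (intro mult_nonneg_nonneg divide_nonneg_nonneg Bochner_Integration.integral_nonneg semigroup_density_nonneg) auto
    show "(\<integral>\<^sup>+y. ennreal (exp (- s * (norm (x - y))\<^sup>2) * h g y) \<partial>lborel) = ennreal ((pi / s) powr (?d / 2) * Q g s)"
      unfolding h_def Q_def R_def by (rule nn_integral_Gaussian_norm_powr[OF that])
    show "AE y in lborel. 0 \<le> exp (- s * (norm (x - y))\<^sup>2) * h g y"
      by (simp add: h_def)
  qed measurable
  have h1: "has_bochner_integral lborel (\<lambda>y. exp (- s * (norm (x - y))\<^sup>2)) ((pi / s) powr (?d / 2))" if "s > 0" for s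
    using nn_integral_Gaussian[OF that, of x] by (intro has_bochner_integral_nn_integral) (auto simp: norm_minus_commute)
  define D where "D = (\<lambda>g s. R powr (- (g / 2)) - Q g s)"
  have Dint: "has_bochner_integral lborel (\<lambda>s. indicator {0<..} s * (s powr (a - 1) * D g s)) (V g)"
    if "0 < g" "g < ?d" for g
    unfolding D_def Q_def V_def by (rule has_bochner_integral_semigroup_defect[OF a that R])
  define T where "T = (\<lambda>s. h \<beta> x * D \<beta>' s + h \<beta>' x * D \<beta> s - D (?d - \<alpha>) s)"
  have inner: "(\<integral>\<^sup>+y. ennreal (exp (- s * (norm (x - y))\<^sup>2) * P y) \<partial>lborel) = ennreal ((pi / s) powr (?d / 2) * T s)"
    and T: "T s \<ge> 0" if s: "s > 0" for s
  proof -
    have "has_bochner_integral lborel (\<lambda>y. h (?d - \<alpha>) x * exp (- s * (norm (x - y))\<^sup>2)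
        - h \<beta> x * (exp (- s * (norm (x - y))\<^sup>2) * h \<beta>' y) - h \<beta>' x * (exp (- s * (norm (x - y))\<^sup>2) * h \<beta> y)
        + exp (- s * (norm (x - y))\<^sup>2) * h (?d - \<alpha>) y)
        (h (?d - \<alpha>) x * (pi / s) powr (?d / 2) - h \<beta> x * ((pi / s) powr (?d / 2) * Q \<beta>' s)
        - h \<beta>' x * ((pi / s) powr (?d / 2) * Q \<beta> s) + (pi / s) powr (?d / 2) * Q (?d - \<alpha>) s)"
      using \<alpha> \<beta> s
      by (intro has_bochner_integral_add has_bochner_integral_diff has_bochner_integral_mult_right hQ h1) auto
    also have "(\<lambda>y. h (?d - \<alpha>) x * exp (- s * (norm (x - y))\<^sup>2)
        - h \<beta> x * (exp (- s * (norm (x - y))\<^sup>2) * h \<beta>' y) - h \<beta>' x * (exp (- s * (norm (x - y))\<^sup>2) * h \<beta> y)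
        + exp (- s * (norm (x - y))\<^sup>2) * h (?d - \<alpha>) y) = (\<lambda>y. exp (- s * (norm (x - y))\<^sup>2) * P y)"
      unfolding hh [symmetric] P_def by (simp add: fun_eq_iff algebra_simps)
    also have "h (?d - \<alpha>) x * (pi / s) powr (?d / 2) - h \<beta> x * ((pi / s) powr (?d / 2) * Q \<beta>' s)
        - h \<beta>' x * ((pi / s) powr (?d / 2) * Q \<beta> s) + (pi / s) powr (?d / 2) * Q (?d - \<alpha>) s
        = (pi / s) powr (?d / 2) * T s"
      unfolding T_def D_def Rp h_def hh[of x, unfolded h_def, symmetric] by (simp add: algebra_simps)
    finally have *: "has_bochner_integral lborel (\<lambda>y. exp (- s * (norm (x - y))\<^sup>2) * P y) ((pi / s) powr (?d / 2) * T s)" .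
    have nn: "AE y in lborel. 0 \<le> exp (- s * (norm (x - y))\<^sup>2) * P y"
      using AE_lborel_singleton[of "0::'a"] by eventually_elim (simp add: P)
    show "(\<integral>\<^sup>+y. ennreal (exp (- s * (norm (x - y))\<^sup>2) * P y) \<partial>lborel) = ennreal ((pi / s) powr (?d / 2) * T s)"
      by (rule nn_integral_eq_has_bochner_integral[OF * nn])
    have "0 \<le> (pi / s) powr (?d / 2) * T s"
      using integral_nonneg_AE[OF nn] * by (simp add: has_bochner_integral_iff)
    moreover have "(pi / s) powr (?d / 2) > 0" using s by simp
    ultimately show "T s \<ge> 0" by (simp add: zero_le_mult_iff)
  qed
  have "(\<integral>\<^sup>+y. ennreal (P y * levy_kernel \<alpha> x y) \<partial>lborel)
    = (\<integral>\<^sup>+y. ennreal (A * P y) * (\<integral>\<^sup>+s. ennreal (indicator {0<..} s * (s powr ((?d + \<alpha>) / 2 - 1) * exp (- s * (norm (x - y))\<^sup>2))) \<partial>lborel) \<partial>lborel)"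
  proof (rule nn_integral_cong_AE)
    show "AE y in lborel. ennreal (P y * levy_kernel \<alpha> x y) =
       ennreal (A * P y) * (\<integral>\<^sup>+s. ennreal (indicator {0<..} s * (s powr ((?d + \<alpha>) / 2 - 1) * exp (- s * (norm (x - y))\<^sup>2))) \<partial>lborel)"
      using AE_lborel_singleton[of "0::'a"] AE_lborel_singleton[of x]
    proof eventually_elim
      case (elim y)
      have 1: "(\<integral>\<^sup>+s. ennreal (indicator {0<..} s * (s powr ((?d + \<alpha>) / 2 - 1) * exp (- s * (norm (x - y))\<^sup>2))) \<partial>lborel)
        = ennreal (Gamma ((?d + \<alpha>) / 2) * norm (x - y) powr (- (?d + \<alpha>)))"
        using elim \<alpha> by (intro nn_integral_norm_powr_Gaussians) auto
      have 2: "P y * levy_kernel \<alpha> x y = A * P y * (Gamma ((?d + \<alpha>) / 2) * norm (x - y) powr (- (?d + \<alpha>)))"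
        by (simp add: levy_kernel_def A_def a_def norm_minus_commute)
      show ?case unfolding 1 2 using A P[OF elim(1)] by (intro ennreal_mult') simp
    qed
  qed
  also have "\<dots> = (\<integral>\<^sup>+y. (\<integral>\<^sup>+s. ennreal (indicator {0<..} s * (A * s powr ((?d + \<alpha>) / 2 - 1))) *
      ennreal (exp (- s * (norm (x - y))\<^sup>2) * P y) \<partial>lborel) \<partial>lborel)"
  proof (rule nn_integral_cong_AE)
    show "AE y in lborel. ennreal (A * P y) * (\<integral>\<^sup>+s. ennreal (indicator {0<..} s * (s powr ((?d + \<alpha>) / 2 - 1) * exp (- s * (norm (x - y))\<^sup>2))) \<partial>lborel)
      = (\<integral>\<^sup>+s. ennreal (indicator {0<..} s * (A * s powr ((?d + \<alpha>) / 2 - 1))) *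
      ennreal (exp (- s * (norm (x - y))\<^sup>2) * P y) \<partial>lborel)"
      using AE_lborel_singleton[of "0::'a"]
    proof eventually_elim
      case (elim y)
      show ?case using A P[OF elim]
        by (subst nn_integral_cmult [symmetric]) (auto simp: ennreal_mult' [symmetric] mult_ac intro!: nn_integral_cong)
    qed
  qed
  also have "\<dots> = (\<integral>\<^sup>+s. (\<integral>\<^sup>+y. ennreal (indicator {0<..} s * (A * s powr ((?d + \<alpha>) / 2 - 1))) *
      ennreal (exp (- s * (norm (x - y))\<^sup>2) * P y) \<partial>lborel) \<partial>lborel)"
    by (rule lborel_pair.Fubini') measurable
  also have "\<dots> = (\<integral>\<^sup>+s. ennreal (A * pi powr (?d / 2) * (indicator {0<..} s * (s powr (a - 1) * T s))) \<partial>lborel)"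
  proof (intro nn_integral_cong)
    fix s :: real
    show "(\<integral>\<^sup>+y. ennreal (indicator {0<..} s * (A * s powr ((?d + \<alpha>) / 2 - 1))) *
      ennreal (exp (- s * (norm (x - y))\<^sup>2) * P y) \<partial>lborel) = ennreal (A * pi powr (?d / 2) * (indicator {0<..} s * (s powr (a - 1) * T s)))"
    proof (cases "s > 0")
      case True
      have "s powr ((?d + \<alpha>) / 2 - 1) = s powr (a - 1) * s powr (?d / 2)"
        unfolding powr_add [symmetric] a_def by (rule arg_cong) (simp add: field_simps)
      then have "s powr ((?d + \<alpha>) / 2 - 1) * (pi / s) powr (?d / 2) = pi powr (?d / 2) * s powr (a - 1)"
        using True by (simp add: powr_divide)
      then have "A * s powr ((?d + \<alpha>) / 2 - 1) * ((pi / s) powr (?d / 2) * T s) = A * pi powr (?d / 2) * (s powr (a - 1) * T s)"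
        by algebra
      then show ?thesis using True A T[OF True]
        by (subst nn_integral_cmult) (simp_all only: inner[OF True], auto simp: ennreal_mult' [symmetric])
    qed simp
  qed
  also have "\<dots> = ennreal (A * pi powr (?d / 2) * (h \<beta> x * V \<beta>' + h \<beta>' x * V \<beta> - V (?d - \<alpha>)))"
  proof (rule nn_integral_eq_has_bochner_integral)
    have "has_bochner_integral lborel (\<lambda>s. A * pi powr (?d / 2) * (h \<beta> x * (indicator {0<..} s * (s powr (a - 1) * D \<beta>' s))
      + h \<beta>' x * (indicator {0<..} s * (s powr (a - 1) * D \<beta> s)) - indicator {0<..} s * (s powr (a - 1) * D (?d - \<alpha>) s)))
      (A * pi powr (?d / 2) * (h \<beta> x * V \<beta>' + h \<beta>' x * V \<beta> - V (?d - \<alpha>)))"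
      using \<alpha> \<beta>
      by (intro has_bochner_integral_add has_bochner_integral_diff has_bochner_integral_mult_right Dint) auto
    then show "has_bochner_integral lborel (\<lambda>s. A * pi powr (?d / 2) * (indicator {0<..} s * (s powr (a - 1) * T s)))
      (A * pi powr (?d / 2) * (h \<beta> x * V \<beta>' + h \<beta>' x * V \<beta> - V (?d - \<alpha>)))"
      by (simp add: T_def algebra_simps)
    show "AE s in lborel. 0 \<le> A * pi powr (?d / 2) * (indicator {0<..} s * (s powr (a - 1) * T s))"
      using A T by (auto simp: indicator_def)
  qed
  also have "V (?d - \<alpha>) = 0" by (simp add: V_def a_def)
  also have "A * pi powr (?d / 2) * (h \<beta> x * V \<beta>' + h \<beta>' x * V \<beta> - 0)
     = 2 * hardy_constant ?d \<alpha> \<beta> * norm x powr (- ?d)"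
  proof -
    have V: "A * pi powr (?d / 2) * V g = hardy_constant ?d \<alpha> g * norm x powr (- (\<alpha> + g))" if "0 < g" "g < ?d - \<alpha>" for g
    proof -
      have e: "(?d - g) / 2 - a = (?d - g - \<alpha>) / 2" "a + g / 2 = (g + \<alpha>) / 2" "\<alpha> + g = g + \<alpha>" by (auto simp: a_def field_simps)
      have "a < (?d - g) / 2" using that by (simp add: a_def field_simps)
      then have "V g = Gamma (a + g / 2) / Gamma (g / 2) * R powr (- (a + g / 2)) * (\<bar>Gamma (- a)\<bar> * Gamma ((?d - g) / 2) / Gamma ((?d - g) / 2 - a))"
        unfolding V_def by (simp only: defect_kernel_integral_eq_Gamma[OF a])
      moreover have "pi powr (- (?d / 2)) * pi powr (?d / 2) = 1" by (simp add: powr_add [symmetric])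
      ultimately show ?thesis using Ga unfolding e Rp A_def hardy_constant_def
        by (simp add: field_simps)
    qed
    have p: "norm x powr (- b) * norm x powr (- c) = norm x powr (- ?d)" if "b + c = ?d" for b c
      using that by (simp add: powr_add [symmetric] flip: that)
    have "A * pi powr (?d / 2) * (h \<beta> x * V \<beta>' + h \<beta>' x * V \<beta> - 0)
      = h \<beta> x * (A * pi powr (?d / 2) * V \<beta>') + h \<beta>' x * (A * pi powr (?d / 2) * V \<beta>)"
      by (simp add: algebra_simps)
    also have "\<dots> = hardy_constant ?d \<alpha> \<beta>' * (norm x powr (- \<beta>) * norm x powr (- (\<alpha> + \<beta>')))
       + hardy_constant ?d \<alpha> \<beta> * (norm x powr (- \<beta>') * norm x powr (- (\<alpha> + \<beta>)))"
      using \<alpha> \<beta> by (subst (1 2) V) (auto simp: h_def)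
    also have "\<dots> = hardy_constant ?d \<alpha> \<beta>' * norm x powr (- ?d) + hardy_constant ?d \<alpha> \<beta> * norm x powr (- ?d)"
      using \<beta> by (subst (1 2) p) auto
    also have "hardy_constant ?d \<alpha> \<beta>' = hardy_constant ?d \<alpha> \<beta>"
    proof -
      have "\<beta>' = ?d - \<alpha> - \<beta>" using \<beta> by simp
      then show ?thesis by (simp only: hardy_constant_dual)
    qed
    finally show ?thesis by simp
  qed
  finally show ?thesis unfolding P_def h_def .
qed

section \<open>Integrals of radial functions\<close>

text \<open>
  Integration in polar coordinates, for radial functions only. Both measures give the half line up to \<open>r\<close> the volume of the ball of
  radius \<open>r\<close>.
\<close>

lemma distr_norm_lborel:
  "distr (lborel :: 'a::euclidean_space measure) borel norm
    = density lborel (\<lambda>r. ennreal (indicator {0<..} r * (real DIM('a) * unit_ball_vol (real DIM('a)) * r powr (real DIM('a) - 1))))"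
    (is "?M = ?N")
proof (rule measure_eqI_generator_eq[of "range atMost" UNIV _ _ "\<lambda>n. {..real n}"])
  let ?d = "real DIM('a)" and ?v = "unit_ball_vol (real DIM('a))"
  show "Int_stable (range (atMost :: real \<Rightarrow> real set))"
    by (auto simp: Int_stable_def)
  have M: "emeasure ?M {..r} = ennreal (?v * (max 0 r) powr ?d)" for r
  proof -
    have "emeasure ?M {..r} = emeasure lborel (norm -` {..r} :: 'a set)"
      by (subst emeasure_distr) auto
    also have "norm -` {..r} = (if r < 0 then {} else cball (0::'a) r)"
      by (auto simp: not_less) (meson norm_ge_zero order_less_le_trans not_less)
    also have "emeasure lborel \<dots> = ennreal (?v * (max 0 r) powr ?d)"
      by (auto simp: emeasure_cball powr_realpow' max_def)
    finally show ?thesis .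
  qed
  have N: "emeasure ?N {..r} = ennreal (?v * (max 0 r) powr ?d)" for r
  proof -
    have "emeasure ?N {..r} = (\<integral>\<^sup>+t. ennreal (?d * ?v * t ^ (DIM('a) - 1)) * indicator {0..max 0 r} t \<partial>lborel)"
      using AE_lborel_singleton[of "0::real"]
      by (subst emeasure_density)
        (auto intro!: nn_integral_cong_AE elim!: eventually_mono simp: indicator_def max_def powr_realpow [symmetric] of_nat_diff Suc_leI)
    also have "\<dots> = ennreal (?v * (max 0 r) ^ DIM('a) - ?v * 0 ^ DIM('a))"
      by (intro nn_integral_FTC_Icc) (auto intro!: derivative_eq_intros)
    also have "?v * (max 0 r) ^ DIM('a) - ?v * 0 ^ DIM('a) = ?v * (max 0 r) powr ?d"
      by (cases "r > 0") (auto simp: powr_realpow max_def)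
    finally show ?thesis .
  qed
  show "emeasure ?M X = emeasure ?N X" if "X \<in> range atMost" for X
    using that M N by auto
  show "sets ?M = sigma_sets UNIV (range atMost)" "sets ?N = sigma_sets UNIV (range atMost)"
    by (auto simp: borel_eq_atMost)
  show "(\<Union>n. {..real n}) = UNIV" using real_arch_simple by auto
  show "emeasure ?M {..real n} \<noteq> \<infinity>" for n unfolding M by simp
qed auto

lemma nn_integral_norm_powr:
  assumes [measurable]: "S \<in> sets borel"
  shows "(\<integral>\<^sup>+(x::'a::euclidean_space). ennreal (indicator S (norm x) * norm x powr (s - real DIM('a))) \<partial>lborel)
    = ennreal (real DIM('a) * unit_ball_vol (real DIM('a))) * (\<integral>\<^sup>+r. ennreal (indicator (S \<inter> {0<..}) r * r powr (s - 1)) \<partial>lborel)"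
proof -
  let ?d = "real DIM('a)" and ?v = "unit_ball_vol (real DIM('a))"
  have "(\<integral>\<^sup>+(x::'a). ennreal (indicator S (norm x) * norm x powr (s - ?d)) \<partial>lborel)
    = (\<integral>\<^sup>+r. ennreal (indicator S r * r powr (s - ?d)) \<partial>distr (lborel :: 'a measure) borel norm)"
    by (subst nn_integral_distr) auto
  also have "\<dots> = (\<integral>\<^sup>+r. ennreal (indicator {0<..} r * (?d * ?v * r powr (?d - 1))) * ennreal (indicator S r * r powr (s - ?d)) \<partial>lborel)"
    unfolding distr_norm_lborel by (subst nn_integral_density) auto
  also have "\<dots> = (\<integral>\<^sup>+r. ennreal (?d * ?v) * ennreal (indicator (S \<inter> {0<..}) r * r powr (s - 1)) \<partial>lborel)"
    by (intro nn_integral_cong)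
      (auto simp: indicator_def ennreal_mult' [symmetric] powr_add [symmetric] mult.assoc)
  also have "\<dots> = ennreal (?d * ?v) * (\<integral>\<^sup>+r. ennreal (indicator (S \<inter> {0<..}) r * r powr (s - 1)) \<partial>lborel)"
    by (rule nn_integral_cmult) measurable
  finally show ?thesis .
qed

lemma nn_integral_norm_powr_shell:
  assumes "0 < a" "a \<le> b"
  shows "(\<integral>\<^sup>+(x::'a::euclidean_space). ennreal (indicator {a..b} (norm x) * norm x powr (- real DIM('a))) \<partial>lborel)
    = ennreal (real DIM('a) * unit_ball_vol (real DIM('a)) * (ln b - ln a))"
proof -
  have "(\<integral>\<^sup>+r. ennreal (indicator ({a..b} \<inter> {0<..}) r * r powr (0 - 1)) \<partial>lborel) = (\<integral>\<^sup>+r. ennreal (inverse r) * indicator {a..b} r \<partial>lborel)"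
    using assms by (intro nn_integral_cong) (auto simp: indicator_def powr_minus)
  also have "\<dots> = ennreal (ln b - ln a)"
    using assms by (intro nn_integral_FTC_Icc) (auto intro!: derivative_eq_intros simp: inverse_eq_divide)
  finally show ?thesis
    using nn_integral_norm_powr[of "{a..b}" 0, where 'a='a] assms by (simp add: ennreal_mult)
qed

lemma nn_integral_norm_powr_outside_ball:
  assumes "0 < a" "0 < s"
  shows "(\<integral>\<^sup>+(x::'a::euclidean_space). ennreal (indicator {a..} (norm x) * norm x powr (- real DIM('a) - s)) \<partial>lborel)
    = ennreal (real DIM('a) * unit_ball_vol (real DIM('a)) * (a powr (- s) / s))"
proof -
  have "(\<integral>\<^sup>+r. ennreal (indicator ({a..} \<inter> {0<..}) r * r powr (- s - 1)) \<partial>lborel) = (\<integral>\<^sup>+r. ennreal (r powr (- s - 1)) * indicator {a..} r \<partial>lborel)"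
    using assms by (intro nn_integral_cong) (auto simp: indicator_def)
  also have "\<dots> = ennreal (0 - (- (1 / s) * a powr (- s)))"
  proof (rule nn_integral_FTC_atLeast)
    have "((\<lambda>r::real. r powr (- s)) \<longlongrightarrow> 0) at_top"
      using assms by (intro tendsto_neg_powr filterlim_ident) auto
    then show "((\<lambda>r::real. - (1 / s) * r powr (- s)) \<longlongrightarrow> 0) at_top"
      by (rule tendsto_mult_right_zero)
  qed (use assms in \<open>auto intro!: derivative_eq_intros\<close>)
  finally show ?thesis
    using nn_integral_norm_powr[of "{a..}" "- s", where 'a='a] assms by (simp add: ennreal_mult' [symmetric] minus_diff_commute)
qed

text \<open>
  The radial integral is a Beta integral with second parameter \<open>1\<close>.
\<close>

lemma nn_integral_norm_powr_unit_ball_finite: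
  assumes "0 < s"
  shows "(\<integral>\<^sup>+(x::'a::euclidean_space). ennreal (indicator {..<1} (norm x) * norm x powr (s - real DIM('a))) \<partial>lborel) < \<infinity>"
proof -
  have "(\<integral>\<^sup>+r. ennreal (indicator ({..<1} \<inter> {0<..}) r * r powr (s - 1)) \<partial>lborel)
      = (\<integral>\<^sup>+r. ennreal (indicator {0<..<1} r * (r powr (s - 1) * (1 - r) powr (1 - 1))) \<partial>lborel)"
    by (intro nn_integral_cong) (auto simp: indicator_def)
  also have "\<dots> = ennreal (Beta s 1)"
    using integrable_Beta_Ioo[of s 1] assms
    by (subst nn_integral_eq_integral) auto
  finally show ?thesis
    using nn_integral_norm_powr[of "{..<1}" s, where 'a='a] by (simp add: ennreal_mult_less_top)
qed

section \<open>The truncated power\<close>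

text \<open>
  The cut at height \<open>1\<close> makes the function vanish outside the unit ball, and the subtraction of \<open>1\<close> avoids a jump at its boundary;
  a jump would make the form infinite for \<open>\<alpha> \<ge> 1\<close>. The cut at height \<open>\<rho>\<^sup>-\<^sup>\<beta>\<close> makes the function constant on the
  ball of radius \<open>\<rho>\<close>, except at the origin, where \<open>0 powr (- \<beta>) = 0\<close> produces the value \<open>0\<close>.
\<close>

definition truncated_power :: "real \<Rightarrow> real \<Rightarrow> 'a::euclidean_space \<Rightarrow> real" where
  "truncated_power \<rho> \<beta> x = max 1 (min (norm x powr (- \<beta>)) (\<rho> powr (- \<beta>))) - 1"

lemma truncated_power_measurable [measurable]: "truncated_power \<rho> \<beta> \<in> borel_measurable borel"
  unfolding truncated_power_def[abs_def] by measurable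

lemma truncated_power_nonneg: "0 \<le> truncated_power \<rho> \<beta> x"
  by (simp add: truncated_power_def)

lemma truncated_power_le: "truncated_power \<rho> \<beta> x \<le> norm x powr (- \<beta>)"
  using powr_ge_zero[of "norm x" "- \<beta>"] unfolding truncated_power_def by linarith

lemma truncated_power_outside:
  assumes "1 \<le> norm x" "0 < \<beta>"
  shows "truncated_power \<rho> \<beta> x = 0"
proof -
  have "norm x powr (- \<beta>) \<le> 1 powr (- \<beta>)" using assms by (intro powr_mono2') auto
  then show ?thesis by (simp add: truncated_power_def)
qed

lemma truncated_power_inside:
  assumes "norm x \<le> \<rho>" "x \<noteq> 0" "0 < \<rho>" "\<rho> < 1" "0 < \<beta>"
  shows "truncated_power \<rho> \<beta> x = \<rho> powr (- \<beta>) - 1"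
proof -
  have "\<rho> powr (- \<beta>) \<le> norm x powr (- \<beta>)" using assms by (intro powr_mono2') auto
  moreover have "1 powr (- \<beta>) \<le> \<rho> powr (- \<beta>)" using assms by (intro powr_mono2') auto
  ultimately show ?thesis by (simp add: truncated_power_def)
qed

text \<open>
  The function \<open>t\<^sup>r - (t - 1)\<^sup>r\<close> is nondecreasing, because its derivative is the increment of the nondecreasing function
  \<open>r t\<^sup>r\<^sup>-\<^sup>1\<close>. For \<open>r < 1\<close> the inequality is reversed.
\<close>

lemma powr_shift_increment:
  fixes s t r :: real
  assumes "1 \<le> t" "t \<le> s" "1 \<le> r"
  shows "(s - 1) powr r - (t - 1) powr r \<le> s powr r - t powr r"
proof (cases "t = s")
  case False
  have "t powr r - (t - 1) powr r \<le> s powr r - (s - 1) powr r"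
  proof (rule DERIV_nonneg_imp_increasing_open[where f = "\<lambda>t. t powr r - (t - 1) powr r"])
    show "t \<le> s" by fact
    show "continuous_on {t..s} (\<lambda>t. t powr r - (t - 1) powr r)"
      using assms by (intro continuous_intros continuous_on_powr') auto
    fix x assume x: "t < x" "x < s"
    have "((\<lambda>t. t powr r - (t - 1) powr r) has_real_derivative r * x powr (r - 1) - r * (x - 1) powr (r - 1)) (at x)"
      using x assms by (auto intro!: derivative_eq_intros)
    moreover have "(x - 1) powr (r - 1) \<le> x powr (r - 1)"
      using x assms by (intro powr_mono2) auto
    ultimately show "\<exists>y. ((\<lambda>t. t powr r - (t - 1) powr r) has_real_derivative y) (at x) \<and> 0 \<le> y"
      using assms by (intro exI conjI) (assumption, simp add: mult_left_mono)
  qed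
  then show ?thesis by simp
qed simp

text \<open>
  The product of the increments of \<open>s\<close> and \<open>s\<^sup>r\<close> decreases under the truncation: clipping to \<open>[1, N]\<close> decreases both increments, and
  subtracting \<open>1\<close> preserves the first and decreases the second by \<open>powr_shift_increment\<close>.
\<close>

lemma clipped_increment_product_le:
  fixes s t N r :: real
  assumes "0 \<le> s" "0 \<le> t" "1 \<le> r" "1 \<le> N"
  defines "\<phi> \<equiv> \<lambda>s. max 1 (min s N) - 1"
  shows "(\<phi> s - \<phi> t) * (\<phi> s powr r - \<phi> t powr r) \<le> (s - t) * (s powr r - t powr r)"
proof -
  have *: "(\<phi> s - \<phi> t) * (\<phi> s powr r - \<phi> t powr r) \<le> (s - t) * (s powr r - t powr r)"
    if "t \<le> s" "0 \<le> t" for s t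
  proof (rule mult_mono)
    let ?s = "max 1 (min s N)" and ?t = "max 1 (min t N)"
    show "\<phi> s - \<phi> t \<le> s - t" using that unfolding \<phi>_def by linarith
    show "0 \<le> \<phi> s powr r - \<phi> t powr r"
      using that assms powr_mono2[of r "\<phi> t" "\<phi> s"] by (auto simp: \<phi>_def)
    have "\<phi> s powr r - \<phi> t powr r \<le> ?s powr r - ?t powr r"
      unfolding \<phi>_def using that assms by (intro powr_shift_increment) auto
    also have "\<dots> \<le> s powr r - t powr r"
    proof (cases "?s = ?t")
      case True
      then show ?thesis using powr_mono2[of r t s] that assms by simp
    next
      case False
      then have "?s \<le> s" "t \<le> ?t" using that assms by linarith+
      then show ?thesis using powr_mono2[of r ?s s] powr_mono2[of r t ?t] that assms by simp
    qed
    finally show "\<phi> s powr r - \<phi> t powr r \<le> s powr r - t powr r" .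
  qed (use that in auto)
  show ?thesis
  proof (cases "t \<le> s")
    case True
    then show ?thesis using * assms by simp
  next
    case False
    then show ?thesis using *[of s t] assms by (simp add: algebra_simps)
  qed
qed

section \<open>Energy of the truncated power\<close>

text \<open>
  Twice the form \<open>sobolev_bregman_form\<close> when \<open>g\<close> is the signed power of \<open>f\<close> of order \<open>p - 1\<close>. Keeping the two functions
  separate makes the symmetry between them available.
\<close>

definition pair_form :: "real \<Rightarrow> ('a::euclidean_space \<Rightarrow> real) \<Rightarrow> ('a \<Rightarrow> real) \<Rightarrow> ennreal" where
  "pair_form \<alpha> f g = (\<integral>\<^sup>+x. (\<integral>\<^sup>+y. ennreal ((f x - f y) * (g x - g y) * levy_kernel \<alpha> x y) \<partial>lborel) \<partial>lborel)"

lemma levy_kernel_nonneg: "0 < \<alpha> \<Longrightarrow> 0 \<le> levy_kernel \<alpha> x y"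
  by (auto simp: levy_kernel_def intro!: Gamma_real_nonneg)

text \<open>
  If one of two points is at least twice as far from the origin as the other, then \<open>m\<close> can be taken as the larger of their norms,
  so that the kernel is controlled by that norm alone.
\<close>

lemma levy_kernel_far_bound:
  fixes x y :: "'a::euclidean_space"
  assumes "0 < \<alpha>" "0 < m" "m / 2 \<le> norm (y - x)"
  shows "levy_kernel \<alpha> x y \<le> 2 powr (2 * \<alpha> + real DIM('a)) * Gamma ((real DIM('a) + \<alpha>) / 2) * pi powr (- (real DIM('a) / 2))
     / \<bar>Gamma (- \<alpha> / 2)\<bar> * m powr (- real DIM('a) - \<alpha>)"
proof -
  let ?A = "2 powr \<alpha> * Gamma ((real DIM('a) + \<alpha>) / 2) * pi powr (- (real DIM('a) / 2)) / \<bar>Gamma (- \<alpha> / 2)\<bar>"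
  have "norm (y - x) powr (- real DIM('a) - \<alpha>) \<le> (m / 2) powr (- real DIM('a) - \<alpha>)"
    using assms by (intro powr_mono2') auto
  moreover have "?A \<ge> 0"
    using assms by (auto intro!: Gamma_real_nonneg)
  ultimately have "levy_kernel \<alpha> x y \<le> ?A * (m / 2) powr (- real DIM('a) - \<alpha>)"
    unfolding levy_kernel_def by (rule mult_left_mono)
  also have "(m / 2) powr (- real DIM('a) - \<alpha>) = 2 powr (real DIM('a) + \<alpha>) * m powr (- real DIM('a) - \<alpha>)"
    using assms by (simp add: powr_divide powr_minus field_simps powr_diff powr_add)
  also have "?A * (2 powr (real DIM('a) + \<alpha>) * m powr (- real DIM('a) - \<alpha>)) =
    (2 powr \<alpha> * 2 powr (real DIM('a) + \<alpha>)) * Gamma ((real DIM('a) + \<alpha>) / 2) * pi powr (- (real DIM('a) / 2))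
     / \<bar>Gamma (- \<alpha> / 2)\<bar> * m powr (- real DIM('a) - \<alpha>)"
    by simp
  also have "2 powr \<alpha> * 2 powr (real DIM('a) + \<alpha>) = 2 powr (2 * \<alpha> + real DIM('a))"
    by (simp add: powr_add [symmetric])
  finally show ?thesis .
qed

text \<open>
  The energy is split according to the position of \<open>x\<close>. In the shell \<open>\<rho> / 2 \<le> |x| \<le> 2\<close> the integral over \<open>y\<close> is at
  most that of the untruncated powers, hence at most \<open>2 \<kappa> |x|\<^sup>-\<^sup>d\<close>; the shell exceeds the set where the function varies by a factor \<open>2\<close> on
  each side in order to contain all interactions at short range. If \<open>|x| < \<rho> / 2\<close>, only \<open>|y| > \<rho>\<close> matters, and the
  increments are at most \<open>\<rho>\<^sup>-\<^sup>(\<^sup>d\<^sup>-\<^sup>\<alpha>\<^sup>)\<close> in product; this, the tail \<open>\<rho>\<^sup>-\<^sup>\<alpha>\<close> of the kernel and the volume \<open>\<rho>\<^sup>d\<close> of the ball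
  balance. If \<open>|x| > 2\<close>, only \<open>|y| < 1\<close> matters, and the integrand is at most a constant times \<open>|y|\<^sup>\<alpha>\<^sup>-\<^sup>d |x|\<^sup>-\<^sup>d\<^sup>-\<^sup>\<alpha>\<close>.
\<close>

lemma truncated_power_form_bound:
  fixes \<alpha> \<beta> r :: real
  assumes \<alpha>: "0 < \<alpha>" "\<alpha> < 2" and \<beta>: "0 < \<beta>" "\<beta> + \<beta> * r = real DIM('a) - \<alpha>" and r: "1 \<le> r"
  obtains K where "\<And>\<rho>. 0 < \<rho> \<Longrightarrow> \<rho> < 1 \<Longrightarrow>
     pair_form \<alpha> (truncated_power \<rho> \<beta> :: 'a::euclidean_space \<Rightarrow> real) (\<lambda>x. truncated_power \<rho> \<beta> x powr r)
     \<le> ennreal (2 * hardy_constant (real DIM('a)) \<alpha> \<beta> * (real DIM('a) * unit_ball_vol (real DIM('a))) * (ln 4 - ln \<rho>) + K)"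
    and "K \<ge> 0"
proof -
  let ?d = "real DIM('a)" and ?\<kappa> = "hardy_constant (real DIM('a)) \<alpha> \<beta>"
  define c where "c = ?d * unit_ball_vol ?d"
  have c: "c > 0" by (simp add: c_def)
  define A where "A = 2 powr (2 * \<alpha> + ?d) * Gamma ((?d + \<alpha>) / 2) * pi powr (- (?d / 2)) / \<bar>Gamma (- \<alpha> / 2)\<bar>"
  have A: "A \<ge> 0" using \<alpha> by (auto simp: A_def intro!: Gamma_real_nonneg)
  have \<kappa>: "?\<kappa> \<ge> 0"
  proof -
    have "\<beta> < ?d - \<alpha>" using \<beta> r mult_pos_pos[of \<beta> r] by linarith
    then show ?thesis unfolding hardy_constant_def
      using \<alpha> \<beta> by (intro divide_nonneg_nonneg mult_nonneg_nonneg Gamma_real_nonneg) auto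
  qed
  obtain B where B: "B \<ge> 0" "(\<integral>\<^sup>+(y::'a). ennreal (indicator {..<1} (norm y) * norm y powr (\<alpha> - ?d)) \<partial>lborel) = ennreal B"
    using nn_integral_norm_powr_unit_ball_finite[OF \<alpha>(1), where 'a='a] by (auto simp: less_top_ennreal)
  define K1 where "K1 = A * (c / \<alpha>) * unit_ball_vol ?d"
  define K2 where "K2 = A * B * (c * (2 powr (- \<alpha>) / \<alpha>))"
  have K: "K1 \<ge> 0" "K2 \<ge> 0" using A B c \<alpha> by (auto simp: K1_def K2_def)
  show thesis
  proof (rule that[of "K1 + K2"])
    show "K1 + K2 \<ge> 0" using K by simp
    fix \<rho> :: real assume \<rho>: "0 < \<rho>" "\<rho> < 1"
    define U where "U = (truncated_power \<rho> \<beta> :: 'a \<Rightarrow> real)"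
    have U0: "0 \<le> U x" for x by (simp add: U_def truncated_power_nonneg)
    define N where "N = \<rho> powr (- \<beta>)"
    have "1 powr (- \<beta>) \<le> \<rho> powr (- \<beta>)" using \<beta> \<rho> by (intro powr_mono2') auto
    then have N: "1 \<le> N" by (simp add: N_def)
    have UN: "U x \<le> N" for x using N unfolding U_def truncated_power_def N_def[symmetric] by linarith
    define F where "F = (\<lambda>x y. (U x - U y) * (U x powr r - U y powr r) * levy_kernel \<alpha> x y)"
    have F0: "F x y = 0" if "U x = U y" for x y using that by (simp add: F_def)
    have middle: "(\<integral>\<^sup>+y. ennreal (F x y) \<partial>lborel) \<le> ennreal (2 * ?\<kappa> * norm x powr (- ?d))" if x: "x \<noteq> 0" for x
    proof -
      have p: "norm y powr (- (\<beta> * r)) = (norm y powr (- \<beta>)) powr r" for y :: 'a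
        by (simp add: powr_powr)
      have "(\<integral>\<^sup>+y. ennreal (F x y) \<partial>lborel) \<le> (\<integral>\<^sup>+y. ennreal ((norm x powr (- \<beta>) - norm y powr (- \<beta>)) *
         (norm x powr (- (\<beta> * r)) - norm y powr (- (\<beta> * r))) * levy_kernel \<alpha> x y) \<partial>lborel)"
        unfolding F_def U_def truncated_power_def p N_def [symmetric]
        using N r \<alpha> by (intro nn_integral_mono ennreal_leI mult_right_mono clipped_increment_product_le levy_kernel_nonneg) auto
      also have "\<dots> = ennreal (2 * ?\<kappa> * norm x powr (- ?d))"
        using \<alpha> \<beta> r x by (intro norm_powr_product_form) auto
      finally show ?thesis .
    qed
    have inner: "(\<integral>\<^sup>+y. ennreal (F x y) \<partial>lborel) \<le> ennreal (A * (c / \<alpha>) * \<rho> powr (- ?d))"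
      if x: "x \<noteq> 0" "norm x < \<rho> / 2" for x
    proof -
      have Ux: "U y = N - 1" if "y \<noteq> 0" "norm y \<le> \<rho>" for y
        unfolding U_def N_def using that \<rho> \<beta> by (intro truncated_power_inside) auto
      have "(\<integral>\<^sup>+y. ennreal (F x y) \<partial>lborel) \<le> (\<integral>\<^sup>+(y::'a). ennreal (\<rho> powr (\<alpha> - ?d) * A) * ennreal (indicator {\<rho>..} (norm y) * norm y powr (- ?d - \<alpha>)) \<partial>lborel)"
      proof (rule nn_integral_mono_AE)
        show "AE y in lborel. ennreal (F x y) \<le> ennreal (\<rho> powr (\<alpha> - ?d) * A) * ennreal (indicator {\<rho>..} (norm y) * norm y powr (- ?d - \<alpha>))"
          using AE_lborel_singleton[of "0::'a"]
        proof eventually_elim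
          case (elim y)
          show ?case
          proof (cases "\<rho> \<le> norm y")
            case False
            then have "F x y = 0" using elim x \<rho> by (intro F0) (simp add: Ux)
            then show ?thesis by simp
          next
            case True
            have ux: "U x = N - 1" using x \<rho> by (intro Ux) auto
            have uy: "U y \<le> N - 1" using N unfolding U_def truncated_power_def N_def[symmetric] by linarith
            have "(U x - U y) * (U x powr r - U y powr r) \<le> N * N powr r"
            proof (rule mult_mono)
              show "U x powr r - U y powr r \<le> N powr r"
                using UN[of x] U0[of x] r powr_mono2[of r "U x" N] powr_ge_zero[of "U y" r] by linarith
              show "0 \<le> U x powr r - U y powr r"
                using ux uy U0[of y] r powr_mono2[of r "U y" "U x"] by simp
            qed (use UN[of x] U0[of y] N in auto)
            also have "N * N powr r = \<rho> powr (- (\<beta> + \<beta> * r))"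
              by (simp add: N_def powr_powr powr_add [symmetric])
            also have "\<dots> = \<rho> powr (\<alpha> - ?d)" unfolding \<beta>(2) by simp
            finally have 1: "(U x - U y) * (U x powr r - U y powr r) \<le> \<rho> powr (\<alpha> - ?d)" .
            have "norm y \<le> norm (y - x) + norm x" by (metis diff_add_cancel norm_triangle_ineq)
            then have "norm y / 2 \<le> norm (y - x)" using x True by linarith
            then have 2: "levy_kernel \<alpha> x y \<le> A * norm y powr (- ?d - \<alpha>)"
              unfolding A_def using \<alpha> elim by (intro levy_kernel_far_bound) auto
            have "F x y \<le> \<rho> powr (\<alpha> - ?d) * (A * norm y powr (- ?d - \<alpha>))"
              unfolding F_def using 1 2 \<alpha> by (intro mult_mono levy_kernel_nonneg) auto
            then show ?thesis using True A by (simp add: ennreal_mult' [symmetric] mult.assoc ennreal_leI)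
          qed
        qed
      qed
      also have "\<dots> = ennreal (\<rho> powr (\<alpha> - ?d) * A) * ennreal (c * (\<rho> powr (- \<alpha>) / \<alpha>))"
        using \<rho> \<alpha> by (subst nn_integral_cmult) (auto simp: nn_integral_norm_powr_outside_ball c_def)
      also have "\<dots> = ennreal (A * (c / \<alpha>) * (\<rho> powr (\<alpha> - ?d) * \<rho> powr (- \<alpha>)))"
        using A by (subst ennreal_mult' [symmetric]) (auto simp: mult_ac)
      also have "\<rho> powr (\<alpha> - ?d) * \<rho> powr (- \<alpha>) = \<rho> powr (- ?d)"
        by (simp add: powr_add [symmetric])
      finally show ?thesis .
    qed
    have outer: "(\<integral>\<^sup>+y. ennreal (F x y) \<partial>lborel) \<le> ennreal (A * B * norm x powr (- ?d - \<alpha>))"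
      if x: "2 \<le> norm x" for x
    proof -
      have out: "U y = 0" if "1 \<le> norm y" for y
        unfolding U_def using that \<beta> by (intro truncated_power_outside) auto
      have "(\<integral>\<^sup>+y. ennreal (F x y) \<partial>lborel) \<le> (\<integral>\<^sup>+(y::'a). ennreal (A * norm x powr (- ?d - \<alpha>)) * ennreal (indicator {..<1} (norm y) * norm y powr (\<alpha> - ?d)) \<partial>lborel)"
      proof (rule nn_integral_mono)
        fix y :: 'a
        show "ennreal (F x y) \<le> ennreal (A * norm x powr (- ?d - \<alpha>)) * ennreal (indicator {..<1} (norm y) * norm y powr (\<alpha> - ?d))"
        proof (cases "norm y < 1")
          case False
          then have "F x y = 0" using x by (intro F0) (simp add: out)
          then show ?thesis by simp
        next
          case True
          have Ux: "U x = 0" using x by (intro out) simp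
          have "(U x - U y) * (U x powr r - U y powr r) = U y * U y powr r"
            using r by (simp add: Ux)
          also have "\<dots> \<le> norm y powr (- \<beta>) * (norm y powr (- \<beta>)) powr r"
            using truncated_power_le[of \<rho> \<beta> y] U0[of y] r unfolding U_def by (intro mult_mono powr_mono2) auto
          also have "\<dots> = norm y powr (- (\<beta> + \<beta> * r))" by (simp add: powr_powr powr_add [symmetric])
          also have "\<dots> = norm y powr (\<alpha> - ?d)" unfolding \<beta>(2) by simp
          finally have 1: "(U x - U y) * (U x powr r - U y powr r) \<le> norm y powr (\<alpha> - ?d)" .
          have "norm x \<le> norm (y - x) + norm y" by (metis diff_add_cancel norm_minus_commute norm_triangle_ineq)
          then have "norm x / 2 \<le> norm (y - x)" using x True by linarith
          then have 2: "levy_kernel \<alpha> x y \<le> A * norm x powr (- ?d - \<alpha>)"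
            unfolding A_def using \<alpha> x by (intro levy_kernel_far_bound) auto
          have "F x y \<le> norm y powr (\<alpha> - ?d) * (A * norm x powr (- ?d - \<alpha>))"
            unfolding F_def using 1 2 \<alpha> by (intro mult_mono levy_kernel_nonneg) auto
          then show ?thesis using True A by (simp add: ennreal_mult' [symmetric] mult_ac ennreal_leI)
        qed
      qed
      also have "\<dots> = ennreal (A * norm x powr (- ?d - \<alpha>)) * ennreal B"
        by (subst nn_integral_cmult) (auto simp: B)
      also have "\<dots> = ennreal (A * B * norm x powr (- ?d - \<alpha>))"
        using A by (subst ennreal_mult' [symmetric]) (auto simp: mult_ac)
      finally show ?thesis .
    qed
    define g1 where "g1 = (\<lambda>x::'a. ennreal (2 * ?\<kappa>) * ennreal (indicator {\<rho> / 2..2} (norm x) * norm x powr (- ?d)))"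
    define g2 where "g2 = (\<lambda>x::'a. ennreal (A * (c / \<alpha>) * \<rho> powr (- ?d)) * indicator (cball 0 (\<rho> / 2)) x)"
    define g3 where "g3 = (\<lambda>x::'a. ennreal (A * B) * ennreal (indicator {2..} (norm x) * norm x powr (- ?d - \<alpha>)))"
    have [measurable]: "g1 \<in> borel_measurable borel" by (simp add: g1_def)
    have [measurable]: "g2 \<in> borel_measurable borel" unfolding g2_def
      by (intro borel_measurable_times_ennreal borel_measurable_const borel_measurable_indicator borel_closed closed_cball)
    have [measurable]: "g3 \<in> borel_measurable borel" by (simp add: g3_def)
    have "(\<integral>\<^sup>+x. g1 x \<partial>lborel) = ennreal (2 * ?\<kappa>) *
       (\<integral>\<^sup>+(x::'a). ennreal (indicator {\<rho> / 2..2} (norm x) * norm x powr (- ?d)) \<partial>lborel)"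
      unfolding g1_def by (rule nn_integral_cmult) simp
    also have "(\<integral>\<^sup>+(x::'a). ennreal (indicator {\<rho> / 2..2} (norm x) * norm x powr (- ?d)) \<partial>lborel)
       = ennreal (c * (ln 2 - ln (\<rho> / 2)))"
      unfolding c_def by (rule nn_integral_norm_powr_shell) (use \<rho> in simp_all)
    finally have int1: "(\<integral>\<^sup>+x. g1 x \<partial>lborel) = ennreal (2 * ?\<kappa>) * ennreal (c * (ln 2 - ln (\<rho> / 2)))" .
    have int2: "(\<integral>\<^sup>+x. g2 x \<partial>lborel) = ennreal (A * (c / \<alpha>) * \<rho> powr (- ?d)) * ennreal (unit_ball_vol ?d * (\<rho> / 2) ^ DIM('a))"
    proof -
      have "(\<integral>\<^sup>+x. g2 x \<partial>lborel) = ennreal (A * (c / \<alpha>) * \<rho> powr (- ?d)) * emeasure lborel (cball (0::'a) (\<rho> / 2))"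
        unfolding g2_def by (rule nn_integral_cmult_indicator) simp
      also have "emeasure lborel (cball (0::'a) (\<rho> / 2)) = ennreal (unit_ball_vol ?d * (\<rho> / 2) ^ DIM('a))"
        using \<rho> by (subst emeasure_cball) simp_all
      finally show ?thesis .
    qed
    have "(\<integral>\<^sup>+x. g3 x \<partial>lborel) = ennreal (A * B) *
       (\<integral>\<^sup>+(x::'a). ennreal (indicator {2..} (norm x) * norm x powr (- ?d - \<alpha>)) \<partial>lborel)"
      unfolding g3_def by (rule nn_integral_cmult) simp
    also have "(\<integral>\<^sup>+(x::'a). ennreal (indicator {2..} (norm x) * norm x powr (- ?d - \<alpha>)) \<partial>lborel)
       = ennreal (c * (2 powr (- \<alpha>) / \<alpha>))"
      unfolding c_def by (rule nn_integral_norm_powr_outside_ball) (use \<alpha> in simp_all)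
    finally have int3: "(\<integral>\<^sup>+x. g3 x \<partial>lborel) = ennreal (A * B) * ennreal (c * (2 powr (- \<alpha>) / \<alpha>))" .
    have "pair_form \<alpha> U (\<lambda>x. U x powr r) = (\<integral>\<^sup>+x. (\<integral>\<^sup>+y. ennreal (F x y) \<partial>lborel) \<partial>lborel)"
      unfolding pair_form_def F_def ..
    also have "\<dots> \<le> (\<integral>\<^sup>+x. g1 x + g2 x + g3 x \<partial>lborel)"
    proof (rule nn_integral_mono_AE)
      show "AE x in lborel. (\<integral>\<^sup>+y. ennreal (F x y) \<partial>lborel) \<le> g1 x + g2 x + g3 x"
        using AE_lborel_singleton[of "0::'a"]
      proof eventually_elim
        case (elim x)
        have le: "u \<le> u + v + w" "v \<le> u + v + w" "w \<le> u + v + w" for u v w :: ennreal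
          by (auto intro: add_increasing add_increasing2 order_refl)
        consider "norm x < \<rho> / 2" | "\<rho> / 2 \<le> norm x" "norm x \<le> 2" | "2 < norm x" by linarith
        then show ?case
        proof cases
          case 1
          have "g2 x = ennreal (A * (c / \<alpha>) * \<rho> powr (- ?d))"
            using 1 by (simp add: g2_def)
          with inner[OF elim 1] have "(\<integral>\<^sup>+y. ennreal (F x y) \<partial>lborel) \<le> g2 x" by simp
          then show ?thesis by (rule order_trans[OF _ le(2)])
        next
          case 2
          have "g1 x = ennreal (2 * ?\<kappa> * norm x powr (- ?d))"
            using 2 \<kappa> by (simp add: g1_def ennreal_mult')
          with middle[OF elim] have "(\<integral>\<^sup>+y. ennreal (F x y) \<partial>lborel) \<le> g1 x" by simp
          then show ?thesis by (rule order_trans[OF _ le(1)])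
        next
          case 3
          then have "g3 x = ennreal (A * B * norm x powr (- ?d - \<alpha>))"
            using A B by (simp add: g3_def ennreal_mult')
          moreover have "2 \<le> norm x" using 3 by simp
          ultimately have "(\<integral>\<^sup>+y. ennreal (F x y) \<partial>lborel) \<le> g3 x" using outer[of x] by simp
          then show ?thesis by (rule order_trans[OF _ le(3)])
        qed
      qed
    qed
    also have "\<dots> = (\<integral>\<^sup>+x. g1 x \<partial>lborel) + (\<integral>\<^sup>+x. g2 x \<partial>lborel) + (\<integral>\<^sup>+x. g3 x \<partial>lborel)"
      by (simp add: nn_integral_add)
    also have "\<dots> = ennreal (2 * ?\<kappa>) * ennreal (c * (ln 2 - ln (\<rho> / 2)))
         + ennreal (A * (c / \<alpha>) * \<rho> powr (- ?d)) * ennreal (unit_ball_vol ?d * (\<rho> / 2) ^ DIM('a))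
         + ennreal (A * B) * ennreal (c * (2 powr (- \<alpha>) / \<alpha>))"
      unfolding int1 int2 int3 ..
    also have "ennreal (2 * ?\<kappa>) * ennreal (c * (ln 2 - ln (\<rho> / 2)))
         + ennreal (A * (c / \<alpha>) * \<rho> powr (- ?d)) * ennreal (unit_ball_vol ?d * (\<rho> / 2) ^ DIM('a))
         + ennreal (A * B) * ennreal (c * (2 powr (- \<alpha>) / \<alpha>))
       \<le> ennreal (2 * ?\<kappa> * c * (ln 4 - ln \<rho>)) + ennreal K1 + ennreal K2"
    proof (intro add_mono)
      have "ln 2 - ln (\<rho> / 2) = ln 4 - ln \<rho>"
        using \<rho> ln_mult[of 2 2] by (simp add: ln_div)
      then show "ennreal (2 * ?\<kappa>) * ennreal (c * (ln 2 - ln (\<rho> / 2))) \<le> ennreal (2 * ?\<kappa> * c * (ln 4 - ln \<rho>))"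
        using \<kappa> by (subst ennreal_mult' [symmetric]) (auto simp: mult.assoc)
      have "\<rho> powr (- ?d) * \<rho> ^ DIM('a) = 1"
        using \<rho> by (simp add: powr_minus powr_realpow)
      then have "\<rho> powr (- ?d) * (\<rho> / 2) ^ DIM('a) = (1 / 2) ^ DIM('a)"
        by (simp add: power_divide)
      also have "\<dots> \<le> 1" by (intro power_le_one) auto
      finally have "K1 * (\<rho> powr (- ?d) * (\<rho> / 2) ^ DIM('a)) \<le> K1 * 1"
        using K(1) by (rule mult_left_mono)
      then have "A * (c / \<alpha>) * \<rho> powr (- ?d) * (unit_ball_vol ?d * (\<rho> / 2) ^ DIM('a)) \<le> K1"
        by (simp add: K1_def mult_ac)
      moreover have "0 \<le> A * (c / \<alpha>) * \<rho> powr (- ?d)" using A c \<alpha> by simp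
      ultimately show "ennreal (A * (c / \<alpha>) * \<rho> powr (- ?d)) * ennreal (unit_ball_vol ?d * (\<rho> / 2) ^ DIM('a)) \<le> ennreal K1"
        by (subst ennreal_mult' [symmetric]) (auto intro: ennreal_leI)
      show "ennreal (A * B) * ennreal (c * (2 powr (- \<alpha>) / \<alpha>)) \<le> ennreal K2"
        using A B unfolding K2_def by (subst ennreal_mult' [symmetric]) auto
    qed
    also have "\<dots> = ennreal (2 * ?\<kappa> * c * (ln 4 - ln \<rho>) + (K1 + K2))"
    proof -
      have "ln \<rho> \<le> ln 4" using \<rho> by simp
      then have "0 \<le> 2 * ?\<kappa> * c * (ln 4 - ln \<rho>)" using \<kappa> c by simp
      then show ?thesis using K by (simp add: add.assoc)
    qed
    finally show "pair_form \<alpha> (truncated_power \<rho> \<beta> :: 'a \<Rightarrow> real) (\<lambda>x. truncated_power \<rho> \<beta> x powr r)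
     \<le> ennreal (2 * ?\<kappa> * (?d * unit_ball_vol ?d) * (ln 4 - ln \<rho>) + (K1 + K2))"
      by (simp add: U_def c_def)
  qed
qed

lemma pair_form_commute: "pair_form \<alpha> f g = pair_form \<alpha> g f"
  unfolding pair_form_def by (simp only: mult.commute[of "f _ - f _"])

section \<open>Sharpness\<close>

text \<open>
  Where the power \<open>s = |x|\<^sup>-\<^sup>\<beta>\<close> is at least \<open>1 / (1 - t)\<close>, that is, for \<open>|x|\<close> up to \<open>(1 - t)\<^sup>1\<^sup>/\<^sup>\<beta>\<close>, subtracting \<open>1\<close> costs at most the
  factor \<open>t\<close>: \<open>s - 1 \<ge> t s\<close>.
\<close>

lemma truncated_power_Hardy_bound:
  fixes \<alpha> \<beta> r t \<rho> :: real
  assumes \<beta>: "0 < \<beta>" "\<beta> + \<beta> * r = real DIM('a) - \<alpha>" and r: "1 \<le> r" and t: "0 < t" "t < 1"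
    and \<rho>: "0 < \<rho>" "\<rho> \<le> (1 - t) powr (1 / \<beta>)"
  shows "ennreal (t powr (1 + r) * (real DIM('a) * unit_ball_vol (real DIM('a))) * (ln ((1 - t) powr (1 / \<beta>)) - ln \<rho>))
    \<le> (\<integral>\<^sup>+(x::'a::euclidean_space). ennreal (truncated_power \<rho> \<beta> x * truncated_power \<rho> \<beta> x powr r / norm x powr \<alpha>) \<partial>lborel)"
proof -
  let ?d = "real DIM('a)"
  define \<delta> where "\<delta> = (1 - t) powr (1 / \<beta>)"
  have \<delta>: "0 < \<delta>" "\<delta> powr (- \<beta>) = 1 / (1 - t)"
    using t \<beta> by (simp_all add: \<delta>_def powr_powr powr_minus field_simps)
  have "(\<integral>\<^sup>+(x::'a). ennreal (t powr (1 + r)) * ennreal (indicator {\<rho>..\<delta>} (norm x) * norm x powr (- ?d)) \<partial>lborel)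
    \<le> (\<integral>\<^sup>+(x::'a). ennreal (truncated_power \<rho> \<beta> x * truncated_power \<rho> \<beta> x powr r / norm x powr \<alpha>) \<partial>lborel)"
  proof (rule nn_integral_mono)
    fix x :: 'a
    show "ennreal (t powr (1 + r)) * ennreal (indicator {\<rho>..\<delta>} (norm x) * norm x powr (- ?d))
      \<le> ennreal (truncated_power \<rho> \<beta> x * truncated_power \<rho> \<beta> x powr r / norm x powr \<alpha>)"
    proof (cases "norm x \<in> {\<rho>..\<delta>}")
      case True
      define s where "s = norm x powr (- \<beta>)"
      have "s \<le> \<rho> powr (- \<beta>)" using True \<rho> \<beta> unfolding s_def by (intro powr_mono2') auto
      moreover have s: "1 / (1 - t) \<le> s"
        unfolding s_def \<delta>(2) [symmetric] using True \<rho> \<beta> by (intro powr_mono2') auto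
      moreover from s have s1: "1 \<le> s"
      proof (rule order_trans[rotated])
        show "1 \<le> 1 / (1 - t)" using t by (simp add: field_simps)
      qed
      ultimately have U: "truncated_power \<rho> \<beta> x = s - 1"
        unfolding truncated_power_def s_def [symmetric] by simp
      have s0: "s \<ge> 0" by (simp add: s_def)
      have ts: "t * s \<le> s - 1" using s t by (simp add: field_simps)
      have "t powr (1 + r) * norm x powr (- ?d) = (t * t powr r) * (norm x powr (- (\<beta> + \<beta> * r)) * norm x powr (- \<alpha>))"
        unfolding \<beta>(2) using t by (simp add: powr_add [symmetric] powr_add)
      also have "norm x powr (- (\<beta> + \<beta> * r)) = s * s powr r"
        by (simp add: s_def powr_powr powr_add [symmetric])
      also have "(t * t powr r) * (s * s powr r * norm x powr (- \<alpha>)) = (t * s) * (t * s) powr r / norm x powr \<alpha>"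
        using t s0 by (simp add: powr_mult powr_minus field_simps)
      also have "\<dots> \<le> (s - 1) * (s - 1) powr r / norm x powr \<alpha>"
        using ts t s0 s1 r mult_nonneg_nonneg[of t s] by (intro divide_right_mono mult_mono powr_mono2) auto
      finally have "t powr (1 + r) * norm x powr (- ?d) \<le> truncated_power \<rho> \<beta> x * truncated_power \<rho> \<beta> x powr r / norm x powr \<alpha>"
        unfolding U .
      then show ?thesis using True by (subst ennreal_mult' [symmetric]) (auto intro: ennreal_leI)
    qed simp
  qed
  also have "(\<integral>\<^sup>+(x::'a). ennreal (t powr (1 + r)) * ennreal (indicator {\<rho>..\<delta>} (norm x) * norm x powr (- ?d)) \<partial>lborel)
     = ennreal (t powr (1 + r)) * (\<integral>\<^sup>+(x::'a). ennreal (indicator {\<rho>..\<delta>} (norm x) * norm x powr (- ?d)) \<partial>lborel)"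
    by (rule nn_integral_cmult) simp
  also have "(\<integral>\<^sup>+(x::'a). ennreal (indicator {\<rho>..\<delta>} (norm x) * norm x powr (- ?d)) \<partial>lborel) = ennreal (?d * unit_ball_vol ?d * (ln \<delta> - ln \<rho>))"
    by (rule nn_integral_norm_powr_shell) (use \<rho> in \<open>simp_all add: \<delta>_def\<close>)
  also have "ennreal (t powr (1 + r)) * ennreal (?d * unit_ball_vol ?d * (ln \<delta> - ln \<rho>))
      = ennreal (t powr (1 + r) * (?d * unit_ball_vol ?d) * (ln \<delta> - ln \<rho>))"
    by (subst ennreal_mult' [symmetric]) (auto simp: mult.assoc)
  finally show ?thesis unfolding \<delta>_def .
qed

lemma integrable_truncated_power:
  fixes \<alpha> \<beta> r \<rho> :: real
  assumes "0 < \<alpha>" and \<beta>: "0 < \<beta>" "\<beta> + \<beta> * r = real DIM('a) - \<alpha>" and r: "1 \<le> r"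
  shows "integrable lborel (\<lambda>x::'a::euclidean_space. truncated_power \<rho> \<beta> x * truncated_power \<rho> \<beta> x powr r)"
proof (rule integrableI_bounded)
  have "(\<integral>\<^sup>+(x::'a). ennreal (norm (truncated_power \<rho> \<beta> x * truncated_power \<rho> \<beta> x powr r)) \<partial>lborel)
    \<le> (\<integral>\<^sup>+(x::'a). ennreal (indicator {..<1} (norm x) * norm x powr (\<alpha> - real DIM('a))) \<partial>lborel)"
  proof (intro nn_integral_mono ennreal_leI)
    fix x :: 'a
    show "norm (truncated_power \<rho> \<beta> x * truncated_power \<rho> \<beta> x powr r) \<le> indicator {..<1} (norm x) * norm x powr (\<alpha> - real DIM('a))"
    proof (cases "norm x < 1")
      case True
      have "truncated_power \<rho> \<beta> x * truncated_power \<rho> \<beta> x powr r \<le> norm x powr (- \<beta>) * (norm x powr (- \<beta>)) powr r"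
        using r by (intro mult_mono powr_mono2 truncated_power_le truncated_power_nonneg) auto
      also have "\<dots> = norm x powr (- (\<beta> + \<beta> * r))" by (simp add: powr_powr powr_add [symmetric])
      also have "\<dots> = norm x powr (\<alpha> - real DIM('a))" unfolding \<beta>(2) by simp
      finally show ?thesis using True truncated_power_nonneg[of \<rho> \<beta> x] by (simp add: abs_mult)
    next
      case False
      then show ?thesis using \<beta> by (simp add: truncated_power_outside)
    qed
  qed
  also have "\<dots> < \<infinity>" by (rule nn_integral_norm_powr_unit_ball_finite) fact
  finally show "(\<integral>\<^sup>+(x::'a). ennreal (norm (truncated_power \<rho> \<beta> x * truncated_power \<rho> \<beta> x powr r)) \<partial>lborel) < \<infinity>" .
qed measurable

text \<open>
  As \<open>\<rho>\<close> tends to \<open>0\<close>, the two sides of the inequality are \<open>\<kappa> \<theta> c ln (1 / \<rho>)\<close> and \<open>k c ln (1 / \<rho>)\<close> up to bounded terms, with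
  \<open>c\<close> the surface area of the unit sphere and \<open>k\<close> the Hardy constant. The factor \<open>\<theta> < 1\<close> is chosen with \<open>\<kappa> \<theta> > k\<close>, which the mean
  of \<open>1\<close> and \<open>k / \<kappa>\<close> satisfies, and \<open>\<rho> = \<delta> exp (- X)\<close> with \<open>X\<close> large enough to beat the bounded terms.
\<close>

lemma truncated_power_violates_Hardy:
  fixes \<alpha> \<beta> r \<kappa> :: real
  assumes \<alpha>: "0 < \<alpha>" "\<alpha> < 2" and \<beta>: "0 < \<beta>" "\<beta> + \<beta> * r = real DIM('a) - \<alpha>" and r: "1 \<le> r"
    and \<kappa>: "hardy_constant (real DIM('a)) \<alpha> \<beta> < \<kappa>"
  obtains \<rho> where "\<not> ennreal \<kappa> * (\<integral>\<^sup>+(x::'a::euclidean_space). ennreal (truncated_power \<rho> \<beta> x * truncated_power \<rho> \<beta> x powr r / norm x powr \<alpha>) \<partial>lborel)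
     \<le> 1 / 2 * pair_form \<alpha> (truncated_power \<rho> \<beta> :: 'a \<Rightarrow> real) (\<lambda>x. truncated_power \<rho> \<beta> x powr r)"
proof -
  let ?d = "real DIM('a)"
  define k where "k = hardy_constant ?d \<alpha> \<beta>"
  define c where "c = ?d * unit_ball_vol ?d"
  have c: "c > 0" by (simp add: c_def)
  have "\<beta> < ?d - \<alpha>" using \<beta> r mult_pos_pos[of \<beta> r] by linarith
  then have k: "0 < k" unfolding k_def hardy_constant_def
    using \<alpha> \<beta> by (intro divide_pos_pos mult_pos_pos Gamma_real_pos) auto
  have kk: "k < \<kappa>" using \<kappa> by (simp add: k_def)
  define \<theta> where "\<theta> = (k + \<kappa>) / (2 * \<kappa>)"
  have \<theta>: "0 < \<theta>" "\<theta> < 1" "k < \<kappa> * \<theta>" using k kk by (auto simp: \<theta>_def field_simps)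
  define t where "t = \<theta> powr (1 / (1 + r))"
  have t: "0 < t" "t < 1" "t powr (1 + r) = \<theta>"
    using \<theta> r powr_less_mono2[of "1 / (1 + r)" \<theta> 1] by (auto simp: t_def powr_powr)
  define \<delta> where "\<delta> = (1 - t) powr (1 / \<beta>)"
  have \<delta>: "0 < \<delta>" "\<delta> < 1" using t \<beta> powr_less_mono2[of "1 / \<beta>" "1 - t" 1] by (auto simp: \<delta>_def)
  obtain K where K: "K \<ge> 0" "\<And>\<rho>. 0 < \<rho> \<Longrightarrow> \<rho> < 1 \<Longrightarrow>
     pair_form \<alpha> (truncated_power \<rho> \<beta> :: 'a \<Rightarrow> real) (\<lambda>x. truncated_power \<rho> \<beta> x powr r)
     \<le> ennreal (2 * k * c * (ln 4 - ln \<rho>) + K)"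
    using truncated_power_form_bound[OF \<alpha> \<beta> r] unfolding k_def c_def by metis
  define M where "M = k * c * (ln 4 - ln \<delta>) + K / 2"
  define q where "q = (\<kappa> * \<theta> - k) * c"
  have q: "q > 0" using \<theta> c by (simp add: q_def)
  define X where "X = (\<bar>M\<bar> + 1) / q"
  have X: "X > 0" using q by (simp add: X_def add_nonneg_pos)
  define \<rho> where "\<rho> = \<delta> * exp (- X)"
  have \<rho>: "0 < \<rho>" "\<rho> \<le> \<delta>" "\<rho> < 1" "ln \<rho> = ln \<delta> - X"
  proof -
    show "\<rho> \<le> \<delta>" using \<delta> X by (simp add: \<rho>_def mult_left_le)
    then show "\<rho> < 1" using \<delta> by simp
  qed (use \<delta> in \<open>simp_all add: \<rho>_def ln_mult\<close>)
  show thesis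
  proof (rule that[of \<rho>], rule notI)
    let ?H = "\<integral>\<^sup>+(x::'a). ennreal (truncated_power \<rho> \<beta> x * truncated_power \<rho> \<beta> x powr r / norm x powr \<alpha>) \<partial>lborel"
    assume le: "ennreal \<kappa> * ?H \<le> 1 / 2 * pair_form \<alpha> (truncated_power \<rho> \<beta> :: 'a \<Rightarrow> real) (\<lambda>x. truncated_power \<rho> \<beta> x powr r)"
    have H: "ennreal (\<theta> * c * X) \<le> ?H"
      using truncated_power_Hardy_bound[OF \<beta> r t(1,2), of \<rho>] \<rho> unfolding \<delta>_def [symmetric] t(3) c_def by simp
    have "ennreal (\<kappa> * (\<theta> * c * X)) = ennreal \<kappa> * ennreal (\<theta> * c * X)"
      using k kk by (intro ennreal_mult') simp
    also have "\<dots> \<le> ennreal \<kappa> * ?H" by (intro mult_left_mono H) simp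
    also note le
    also have "1 / 2 * pair_form \<alpha> (truncated_power \<rho> \<beta> :: 'a \<Rightarrow> real) (\<lambda>x. truncated_power \<rho> \<beta> x powr r)
        \<le> 1 / 2 * ennreal (2 * k * c * (ln 4 - ln \<rho>) + K)"
      by (intro mult_left_mono K(2) \<rho>) simp
    also have "(1 / 2 :: ennreal) = ennreal (1 / 2)"
      by (simp add: divide_ennreal_def)
    also have "ennreal (1 / 2) * ennreal (2 * k * c * (ln 4 - ln \<rho>) + K) = ennreal (k * c * X + M)"
      by (subst ennreal_mult' [symmetric]) (simp_all add: M_def \<rho>(4) algebra_simps)
    finally have "ennreal (\<kappa> * (\<theta> * c * X)) \<le> ennreal (k * c * X + M)" .
    moreover have "0 < \<kappa> * (\<theta> * c * X)" using k kk \<theta> c X by simp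
    ultimately have "\<kappa> * (\<theta> * c * X) \<le> k * c * X + M"
      by (simp add: ennreal_le_iff2)
    then have "q * X \<le> M" by (simp add: q_def algebra_simps)
    moreover have "q * X = \<bar>M\<bar> + 1" using q by (simp add: X_def)
    ultimately show False by linarith
  qed
qed

text \<open>
  For \<open>p \<ge> 2\<close> the function that violates the inequality is the truncated power \<open>U\<close> with \<open>\<beta> = (d - \<alpha>) / p\<close>. For
  \<open>p < 2\<close> it is \<open>U\<^sup>r\<close> with \<open>r = 1 / (p - 1)\<close>, whose power of order \<open>p - 1\<close> is \<open>U\<close>, and \<open>U\<close> is built with the dual exponent
  \<open>d - \<alpha> - (d - \<alpha>) / p\<close>.
\<close>

theorem theorem2:
  fixes p \<alpha> :: real
  assumes "1 < p"
    and "0 < \<alpha>" and "\<alpha> < min (real CARD('n::finite)) 2"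
  shows "\<not> (\<exists>\<kappa> > hardy_constant (real CARD('n)) \<alpha> ((real CARD('n) - \<alpha>) / p).
    \<forall>u \<in> (Lp_functions p :: (real ^ 'n \<Rightarrow> real) set).
      sobolev_bregman_form \<alpha> p u
        \<ge> ennreal \<kappa> * (\<integral>\<^sup>+x. ennreal (\<bar>u x\<bar> powr p / norm x powr \<alpha>) \<partial>lborel))"
proof (rule notI, elim exE conjE)
  let ?d = "real CARD('n)"
  fix \<kappa> assume \<kappa>: "hardy_constant ?d \<alpha> ((?d - \<alpha>) / p) < \<kappa>"
  assume "\<forall>u \<in> (Lp_functions p :: (real ^ 'n \<Rightarrow> real) set). ennreal \<kappa> * (\<integral>\<^sup>+x. ennreal (\<bar>u x\<bar> powr p / norm x powr \<alpha>) \<partial>lborel) \<le> sobolev_bregman_form \<alpha> p u"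
  then have Hardy: "ennreal \<kappa> * (\<integral>\<^sup>+x. ennreal (U x * V x / norm x powr \<alpha>) \<partial>lborel) \<le> 1 / 2 * pair_form \<alpha> u v"
    if "u \<in> borel_measurable borel" "integrable lborel (\<lambda>x. U x * V x)"
      "\<And>x. \<bar>u x\<bar> powr p = U x * V x" "\<And>x. signed_powr (u x) (p - 1) = v x"
    for u v U V :: "real ^ 'n \<Rightarrow> real"
    using that by (auto simp: Lp_functions_def sobolev_bregman_form_def pair_form_def)
  have \<alpha>: "0 < \<alpha>" "\<alpha> < 2" "\<alpha> < ?d" using assms by auto
  show False
  proof (cases "2 \<le> p")
    case True
    define \<beta> r where "\<beta> = (?d - \<alpha>) / p" and "r = p - 1"
    have \<beta>: "0 < \<beta>" "\<beta> + \<beta> * r = real DIM(real ^ 'n) - \<alpha>" and r: "1 \<le> r"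
      using True \<alpha> by (auto simp: \<beta>_def r_def field_simps)
    obtain \<rho> where \<rho>: "\<not> ennreal \<kappa> * (\<integral>\<^sup>+(x::real ^ 'n). ennreal (truncated_power \<rho> \<beta> x * truncated_power \<rho> \<beta> x powr r / norm x powr \<alpha>) \<partial>lborel)
     \<le> 1 / 2 * pair_form \<alpha> (truncated_power \<rho> \<beta> :: real ^ 'n \<Rightarrow> real) (\<lambda>x. truncated_power \<rho> \<beta> x powr r)"
      using truncated_power_violates_Hardy[OF \<alpha>(1,2) \<beta> r, of \<kappa>] \<kappa> by (auto simp: \<beta>_def)
    have "\<bar>truncated_power \<rho> \<beta> x\<bar> powr p = truncated_power \<rho> \<beta> x * truncated_power \<rho> \<beta> x powr r"
      "signed_powr (truncated_power \<rho> \<beta> x) (p - 1) = truncated_power \<rho> \<beta> x powr r" for x :: "real ^ 'n"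
      using truncated_power_nonneg[of \<rho> \<beta> x] powr_mult_base[of "truncated_power \<rho> \<beta> x" r]
      by (auto simp: r_def signed_powr_def sgn_if)
    from Hardy[OF truncated_power_measurable integrable_truncated_power[OF \<alpha>(1) \<beta> r] this]
    show False using \<rho> by simp
  next
    case False
    define \<beta> r where "\<beta> = (?d - \<alpha>) - (?d - \<alpha>) / p" and "r = 1 / (p - 1)"
    have \<beta>: "0 < \<beta>" "\<beta> + \<beta> * r = real DIM(real ^ 'n) - \<alpha>" and r: "1 \<le> r"
    proof -
      have "0 < (?d - \<alpha>) * (1 - 1 / p)" using \<open>1 < p\<close> \<alpha> by (intro mult_pos_pos) auto
      then show "0 < \<beta>" by (simp add: \<beta>_def algebra_simps diff_divide_distrib)
    qed (use False \<open>1 < p\<close> in \<open>auto simp: \<beta>_def r_def field_simps\<close>)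
    have "hardy_constant ?d \<alpha> \<beta> < \<kappa>" unfolding \<beta>_def hardy_constant_dual by (rule \<kappa>)
    then obtain \<rho> where \<rho>: "\<not> ennreal \<kappa> * (\<integral>\<^sup>+(x::real ^ 'n). ennreal (truncated_power \<rho> \<beta> x * truncated_power \<rho> \<beta> x powr r / norm x powr \<alpha>) \<partial>lborel)
     \<le> 1 / 2 * pair_form \<alpha> (truncated_power \<rho> \<beta> :: real ^ 'n \<Rightarrow> real) (\<lambda>x. truncated_power \<rho> \<beta> x powr r)"
      using truncated_power_violates_Hardy[OF \<alpha>(1,2) \<beta> r, of \<kappa>] by auto
    have rp: "r * p = 1 + r" "r * (p - 1) = 1"
      using \<open>1 < p\<close> by (auto simp: r_def field_simps)
    have "\<bar>truncated_power \<rho> \<beta> x powr r\<bar> powr p = truncated_power \<rho> \<beta> x * truncated_power \<rho> \<beta> x powr r"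
      "signed_powr (truncated_power \<rho> \<beta> x powr r) (p - 1) = truncated_power \<rho> \<beta> x" for x :: "real ^ 'n"
      using truncated_power_nonneg[of \<rho> \<beta> x] powr_mult_base[of "truncated_power \<rho> \<beta> x" r] rp
      by (auto simp: powr_powr signed_powr_def sgn_if)
    from Hardy[OF _ integrable_truncated_power[OF \<alpha>(1) \<beta> r] this]
    show False using \<rho> by (simp add: pair_form_commute[of \<alpha> "truncated_power \<rho> \<beta>"])
  qed
qed

end
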